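(* Let $m,k$ be positive integers with $3\leq k\leq m^2/2$, let $\Delta$ be a subgraph of $\mathbf{K}_{m,m}$ with exactly $k$ edges, let $K$, $\tau$, $\mathcal{D}(\Delta)$, $\widehat{\mathcal{D}}(\Delta)$, $x_i$, $y_j$ be as defined in the context, and suppose that $\Delta^\tau=\Delta^x$ for some $x\in K$, so that $\widehat{\mathcal{D}}(\Delta)=\mathcal{D}(\Delta)$. Then: (a) $\mathcal{D}(\Delta)$ is a $2$-design if and only if the number of $2$-paths in $\Delta$ is $$\sum_{i=1}^m x_i(x_i-1)=\sum_{j=1}^m y_j(y_j-1)=\frac{k(k-1)}{m+1},$$ and if this is the case then $\mathcal{D}(\Delta)$ is a $2$-$(m^2,k,\lambda)$ design with $$\lambda=\frac{k(k-1)(m-1)!(m-2)!}{(m+1)|K_\Delta|}.$$ (b) $\mathcal{D}(\Delta)$ is a $3$-design if and only if the conditions in part (a) hold and also the following two additional conditions hold: (i) the number of $3$-claws in $\Delta$ is $$2\sum_{i=1}^m \binom{x_i}{3}=2\sum_{j=1}^m \binom{y_j}{3}=\frac{k(k-1)(k-2)(m-2)}{3(m+1)(m^2-2)};$$ (ii) the number of $3$-paths in $\Delta$ is $$\frac{k(k-1)(k-2)(m-1)}{(m+1)(m^2-2)}.$$ If these conditions hold, then $\mathcal{D}(\Delta)$ is a $3$-$(m^2,k,\lambda)$ design with $$\lambda=\frac{k(k-1)(k-2)(m-1)!(m-2)!}{(m+1)(m^2-2)|K_\Delta|}.$$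
   Context: Let $\mathcal{R}=\{R_1,\dots,R_m\}$ and $\mathcal{C}=\{C_1,\dots,C_m\}$ be disjoint sets of size $m$, let $\mathcal{P}=\mathcal{R}\times\mathcal{C}$, and let $\mathbf{K}_{m,m}$ be the complete bipartite graph with vertex set $\mathcal{R}\cup\mathcal{C}$ and edges all pairs $\{R,C\}$ with $R\in\mathcal{R}$, $C\in\mathcal{C}$. Subgraphs $\Delta$ of $\mathbf{K}_{m,m}$ are identified with their edge sets (isolated vertices are irrelevant). For a subgraph $\Delta$ put $B(\Delta)=\{(R,C)\in\mathcal{P} : \{R,C\}\text{ is an edge of }\Delta\}$. Let $x_i$ be the number of edges of $\Delta$ incident with $R_i$, and $y_j$ the number of edges of $\Delta$ incident with $C_j$. Let $K=\mathrm{Sym}(\mathcal{R})\times\mathrm{Sym}(\mathcal{C})\cong\mathrm{S}_m\times\mathrm{S}_m$ act on $\mathbf{K}_{m,m}$ and on $\mathcal{P}$ in the natural way; let $\tau$ be the automorphism of $\mathbf{K}_{m,m}$ interchanging $R_i$ and $C_i$ for each $i$, which acts on $\mathcal{P}$ by $(R_i,C_j)\mapsto(R_j,C_i)$; and let $G=\langle K,\tau\rangle\cong \mathrm{S}_m\wr\mathrm{S}_2$. $K_\Delta$ is the stabiliser of $\Delta$ in $K$ (equivalently the setwise stabiliser of $B(\Delta)$). Define the incidence structures $\mathcal{D}(\Delta)=(\mathcal{P},\{B(\Delta^g) : g\in K\})$ and $\widehat{\mathcal{D}}(\Delta)=(\mathcal{P},\{B(\Delta^g) : g\in G\})$, with incidence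 being inclusion. An incidence structure with point set $\mathcal{P}$ and blocks that are subsets of $\mathcal{P}$ is a $t$-$(v,k,\lambda)$ design ($t,v,k,\lambda$ positive integers) if $|\mathcal{P}|=v$, every block has size $k$, and every $t$-subset of $\mathcal{P}$ lies in exactly $\lambda$ blocks; it is a $t$-design if this holds for some $v,k,\lambda$. A $u$-path in $\Delta$ is a (not necessarily induced) subgraph that is a path with $u$ edges and $u+1$ distinct vertices (a path and its reversal are the same). A $3$-claw in $\Delta$ is a subgraph isomorphic to $\mathbf{K}_{1,3}$. *)

theory Defs
  imports Complex_Main "HOL-Combinatorics.Permutations" "HOL-Algebra.Group_Action"
    "HOL-Algebra.Generated_Groups"
begin

section \<open>Subgraphs of the complete bipartite graph\<close>

text \<open>
  Vertices \<open>R\<^sub>i\<close> and \<open>C\<^sub>j\<close> are \<open>Row i\<close> and \<open>Col j\<close> with \<open>i, j\<close> ranging over \<open>{1..m}\<close>.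
  Edges are two-element vertex sets, and a subgraph is identified with its edge set.
\<close>

datatype vertex = Row nat | Col nat

type_synonym graph = "vertex set set"

definition rows :: "nat \<Rightarrow> vertex set" where
  "rows m = Row ` {1..m}"

definition cols :: "nat \<Rightarrow> vertex set" where
  "cols m = Col ` {1..m}"

definition complete_bipartite :: "vertex set \<Rightarrow> vertex set \<Rightarrow> graph" where
  "complete_bipartite A B = {{a, b} | a b. a \<in> A \<and> b \<in> B}"

definition Kmm :: "nat \<Rightarrow> graph" where
  "Kmm m = complete_bipartite (rows m) (cols m)"

definition vertex_degree :: "graph \<Rightarrow> vertex \<Rightarrow> nat" where
  "vertex_degree \<Delta> v = card {e \<in> \<Delta>. v \<in> e}"

definition path_edges :: "vertex list \<Rightarrow> graph" where
  "path_edges vs = {{vs ! i, vs ! Suc i} | i. Suc i < length vs}"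

text \<open>
  A \<open>u\<close>-path is a subgraph, hence an edge set; so a vertex sequence and its reversal
  are counted once (for \<open>u \<ge> 1\<close>).
\<close>

definition paths :: "nat \<Rightarrow> graph \<Rightarrow> graph set" where
  "paths u \<Delta> = {F. F \<subseteq> \<Delta> \<and> (\<exists>vs. length vs = u + 1 \<and> distinct vs \<and> F = path_edges vs)}"

definition claws3 :: "graph \<Rightarrow> graph set" where
  "claws3 \<Delta> = {F. F \<subseteq> \<Delta> \<and>
     (\<exists>A B. card A = 1 \<and> card B = 3 \<and> A \<inter> B = {} \<and> F = complete_bipartite A B)}"

section \<open>The groups and their action\<close>

text \<open>
  \<open>sym_on S\<close> is the symmetric group on \<open>S\<close>, generalising \<open>sym_group\<close> of HOL-Algebra from
  \<open>{1..n}\<close> to an arbitrary set; permutations are extended by the identity outside \<open>S\<close>.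
\<close>

definition sym_on :: "'a set \<Rightarrow> ('a \<Rightarrow> 'a) monoid" where
  "sym_on S = \<lparr> carrier = {p. p permutes S}, mult = (\<circ>), one = id \<rparr>"

lemma sym_on_is_group: "group (sym_on S)"
proof (rule groupI)
  fix p assume "p \<in> carrier (sym_on S)"
  then have "inv_into UNIV p permutes S" "inv_into UNIV p \<circ> p = id"
    by (auto simp: sym_on_def permutes_inv permutes_inv_o)
  then show "\<exists>q \<in> carrier (sym_on S). q \<otimes>\<^bsub>sym_on S\<^esub> p = \<one>\<^bsub>sym_on S\<^esub>"
    by (auto simp: sym_on_def)
qed (auto simp: sym_on_def permutes_compose comp_assoc permutes_id)

text \<open>
  The groups \<open>K\<close> and \<open>G\<close> are realised as permutation groups on the vertex set; \<open>K\<close> is the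
  internal direct product of the symmetric groups on the two parts.
\<close>

definition K_group :: "nat \<Rightarrow> (vertex \<Rightarrow> vertex) monoid" where
  "K_group m = (sym_on (rows m \<union> cols m))
     \<lparr> carrier := {p \<circ> q | p q. p \<in> carrier (sym_on (rows m)) \<and> q \<in> carrier (sym_on (cols m))} \<rparr>"

definition tau :: "nat \<Rightarrow> vertex \<Rightarrow> vertex" where
  "tau m v = (case v of
      Row i \<Rightarrow> if i \<in> {1..m} then Col i else Row i
    | Col i \<Rightarrow> if i \<in> {1..m} then Row i else Col i)"

lemma K_group_subset: "carrier (K_group m) \<subseteq> carrier (sym_on (rows m \<union> cols m))"
  by (auto simp: K_group_def sym_on_def intro!: permutes_compose intro: permutes_subset)

lemma tau_mem: "tau m \<in> carrier (sym_on (rows m \<union> cols m))"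
proof -
  have "tau m (tau m v) = v" for v
    by (cases v) (auto simp: tau_def)
  then have "bij (tau m)"
    by (metis bijI')
  moreover have "tau m v = v" if "v \<notin> rows m \<union> cols m" for v
    using that by (cases v) (auto simp: tau_def rows_def cols_def)
  ultimately show ?thesis
    by (simp add: sym_on_def permutes_def bij_iff)
qed

definition G_group :: "nat \<Rightarrow> (vertex \<Rightarrow> vertex) monoid" where
  "G_group m = (sym_on (rows m \<union> cols m))
     \<lparr> carrier := generate (sym_on (rows m \<union> cols m)) (insert (tau m) (carrier (K_group m))) \<rparr>"

definition graph_act :: "(vertex \<Rightarrow> vertex) \<Rightarrow> graph \<Rightarrow> graph" where
  "graph_act g \<Delta> = (\<lambda>e. g ` e) ` \<Delta>"

section \<open>Incidence structures and designs\<close>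

text \<open>
  An incidence structure is a pair of a point set and a set of blocks, each block being a
  set of points.
\<close>

type_synonym 'p incidence_structure = "'p set \<times> 'p set set"

definition is_t_v_k_design ::
  "nat \<Rightarrow> nat \<Rightarrow> nat \<Rightarrow> nat \<Rightarrow> 'p incidence_structure \<Rightarrow> bool" where
  "is_t_v_k_design t v k l D \<longleftrightarrow>
     0 < t \<and> 0 < v \<and> 0 < k \<and> 0 < l \<and>
     card (fst D) = v \<and>
     (\<forall>B \<in> snd D. B \<subseteq> fst D \<and> card B = k) \<and>
     (\<forall>T. T \<subseteq> fst D \<and> card T = t \<longrightarrow> card {B \<in> snd D. T \<subseteq> B} = l)"

definition is_t_design :: "nat \<Rightarrow> 'p incidence_structure \<Rightarrow> bool" where
  "is_t_design t D \<longleftrightarrow> (\<exists>v k l. is_t_v_k_design t v k l D)"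

definition points :: "nat \<Rightarrow> (vertex \<times> vertex) set" where
  "points m = rows m \<times> cols m"

definition block :: "nat \<Rightarrow> graph \<Rightarrow> (vertex \<times> vertex) set" where
  "block m \<Delta> = {(r, c) \<in> points m. {r, c} \<in> \<Delta>}"

definition design :: "nat \<Rightarrow> graph \<Rightarrow> (vertex \<times> vertex) incidence_structure" where
  "design m \<Delta> = (points m, {block m (graph_act g \<Delta>) | g. g \<in> carrier (K_group m)})"

definition design_hat :: "nat \<Rightarrow> graph \<Rightarrow> (vertex \<times> vertex) incidence_structure" where
  "design_hat m \<Delta> = (points m, {block m (graph_act g \<Delta>) | g. g \<in> carrier (G_group m)})"

definition K_stabilizer :: "nat \<Rightarrow> graph \<Rightarrow> (vertex \<Rightarrow> vertex) set" where
  "K_stabilizer m \<Delta> = stabilizer (K_group m) graph_act \<Delta>"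

end

theory Submission
  imports Defs
begin

text \<open>
  An edge \<open>{R\<^sub>i, C\<^sub>j}\<close> is identified with the cell \<open>(i, j)\<close> of an \<open>m \<times> m\<close> grid, so that adjacent
  edges are cells on a common line, and \<open>\<Delta>\<close> becomes a set \<open>A\<close> of cells. By the hypothesis on
  \<open>\<tau>\<close>, the set of blocks is invariant under the whole group \<open>G\<close>, hence the number of blocks through
  a \<open>t\<close>-set depends only on its \<open>G\<close>-orbit. Counting incident pairs of a block and a member of an
  orbit shows that the blocks form a \<open>t\<close>-design if and only if each orbit of \<open>t\<close>-sets meets the
  subsets of \<open>A\<close> in the expected proportion. For \<open>t = 2, 3\<close> the orbits are classified by the
  number \<open>i\<close> of collinear pairs contained in a \<open>t\<close>-set: for \<open>t = 3\<close>, the value \<open>3\<close> gives the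
  claws and \<open>2\<close> the 3-paths. Writing \<open>n\<^sub>i\<close> for the number of 3-subsets of \<open>A\<close> in class \<open>i\<close> and \<open>P\<close>
  for the number of its collinear pairs, we have \<open>\<Sum>n\<^sub>i = (k choose 3)\<close> and \<open>\<Sum>i n\<^sub>i = P(k - 2)\<close>, so
  the conditions for all four classes amount to those on \<open>P\<close>, \<open>n\<^sub>3\<close> and \<open>n\<^sub>2\<close>.
\<close>

section \<open>Block designs from class-wise counts\<close>

text \<open>Double counting of the pairs \<open>T \<subseteq> B\<close> with \<open>T\<close> in
  \<open>\<O>\<close> and \<open>B\<close> in \<open>\<B>\<close>.\<close>

lemma uniform_cover_count:
  assumes "finite \<O>" "finite \<B>"
    and "\<forall>T\<in>\<O>. card {B \<in> \<B>. T \<subseteq> B} = l"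
    and "\<forall>B\<in>\<B>. card {T \<in> \<O>. T \<subseteq> B} = n"
  shows "card \<O> * l = card \<B> * n"
proof -
  have "(\<Sum>T\<in>\<O>. card {B \<in> \<B>. T \<subseteq> B}) = n * card \<B>"
    using assms by (intro sum_multicount) auto
  with assms(3) show ?thesis by (simp add: mult.commute)
qed

text \<open>The same double count with all \<open>t\<close>-subsets of \<open>P\<close> as the
  family: each block contains \<open>k choose t\<close> of them.\<close>

lemma design_index:
  assumes "finite P" "finite \<B>" "\<And>B. B \<in> \<B> \<Longrightarrow> B \<subseteq> P" "\<And>B. B \<in> \<B> \<Longrightarrow> card B = k"
    and "\<forall>T. T \<subseteq> P \<and> card T = t \<longrightarrow> card {B \<in> \<B>. T \<subseteq> B} = l"
  shows "l * (card P choose t) = card \<B> * (k choose t)"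
proof -
  have "card {T. T \<subseteq> P \<and> card T = t} * l = card \<B> * (k choose t)"
  proof (rule uniform_cover_count)
    show "\<forall>B\<in>\<B>. card {T \<in> {T. T \<subseteq> P \<and> card T = t}. T \<subseteq> B} = k choose t"
    proof
      fix B assume B: "B \<in> \<B>"
      then have "{T \<in> {T. T \<subseteq> P \<and> card T = t}. T \<subseteq> B} = {T. T \<subseteq> B \<and> card T = t}"
        using assms(3) by blast
      then show "card {T \<in> {T. T \<subseteq> P \<and> card T = t}. T \<subseteq> B} = k choose t"
        using n_subsets[of B t] assms(4)[OF B] finite_subset[OF assms(3)[OF B] assms(1)] by simp
    qed
  qed (use assms in auto)
  then show ?thesis using n_subsets[OF assms(1), of t] by (simp add: mult.commute)
qed

section \<open>Block systems whose covering numbers depend only on a class of the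
  \<open>t\<close>-set\<close>

context
  fixes P :: "'a set" and \<B> :: "'a set set" and t k :: nat
    and cls :: "'a set \<Rightarrow> nat" and n :: "nat \<Rightarrow> nat"
  assumes fin: "finite P" "finite \<B>" and ne: "\<B> \<noteq> {}"
    and sub: "\<And>B. B \<in> \<B> \<Longrightarrow> B \<subseteq> P" and card_block: "\<And>B. B \<in> \<B> \<Longrightarrow> card B = k"
    and tk: "t \<le> k"
    and const: "\<And>T T'. \<lbrakk>T \<subseteq> P; card T = t; T' \<subseteq> P; card T' = t; cls T = cls T'\<rbrakk>
      \<Longrightarrow> card {B \<in> \<B>. T \<subseteq> B} = card {B \<in> \<B>. T' \<subseteq> B}"
    and class_count: "\<And>B i. B \<in> \<B> \<Longrightarrow> card {T. T \<subseteq> B \<and> card T = t \<and> cls T = i} = n i"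
begin

text \<open>Double counting restricted to the class of \<open>T\<close>: on it the covering number
  is constant by \<open>const\<close>, and every block contains the same number of its members by
  \<open>class_count\<close>.\<close>

lemma class_index:
  assumes "T \<subseteq> P" "card T = t"
  shows "card {S. S \<subseteq> P \<and> card S = t \<and> cls S = cls T} * card {B \<in> \<B>. T \<subseteq> B}
    = card \<B> * n (cls T)"
proof (rule uniform_cover_count)
  let ?O = "{S. S \<subseteq> P \<and> card S = t \<and> cls S = cls T}"
  show "\<forall>B\<in>\<B>. card {S \<in> ?O. S \<subseteq> B} = n (cls T)"
  proof
    fix B assume B: "B \<in> \<B>"
    then have "{S \<in> ?O. S \<subseteq> B} = {S. S \<subseteq> B \<and> card S = t \<and> cls S = cls T}"
      using sub by blast
    then show "card {S \<in> ?O. S \<subseteq> B} = n (cls T)" using class_count[OF B] by simp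
  qed
  show "\<forall>S\<in>?O. card {B \<in> \<B>. S \<subseteq> B} = card {B \<in> \<B>. T \<subseteq> B}"
    using const assms by blast
qed (use fin in auto)

text \<open>The right-hand side says that each class has the same share among the
  \<open>t\<close>-subsets of a block as among all \<open>t\<close>-subsets of \<open>P\<close>. If
  the covering number is constant, \<open>design_index\<close> and \<open>class_index\<close>
  together eliminate it and \<open>card \<B>\<close>. Conversely, the proportions turn
  \<open>class_index\<close> into a formula for the covering number in which the class no longer
  occurs.\<close>

theorem design_iff_class_counts:
  "(\<exists>l>0. \<forall>T. T \<subseteq> P \<and> card T = t \<longrightarrow> card {B \<in> \<B>. T \<subseteq> B} = l) \<longleftrightarrow>
   (\<forall>i. n i * (card P choose t) =
        card {T. T \<subseteq> P \<and> card T = t \<and> cls T = i} * (k choose t))" (is "?L \<longleftrightarrow> ?R")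
proof -
  have b: "card \<B> > 0" using fin ne by (simp add: card_gt_0_iff)
  obtain B0 where B0: "B0 \<in> \<B>" using ne by blast
  have kv: "k \<le> card P" using sub[OF B0] card_block[OF B0] card_mono[OF fin(1)] by metis
  have pos: "card P choose t > 0" "k choose t > 0" using tk kv by (auto simp: zero_less_binomial_iff)
  show ?thesis
  proof
    assume ?L
    then obtain l where l: "\<forall>T. T \<subseteq> P \<and> card T = t \<longrightarrow> card {B \<in> \<B>. T \<subseteq> B} = l" by blast
    show ?R
    proof
      fix i
      let ?O = "{T. T \<subseteq> P \<and> card T = t \<and> cls T = i}"
      show "n i * (card P choose t) = card ?O * (k choose t)"
      \<comment> \<open>An empty class offers no \<open>T\<close> for \<open>class_index\<close>;
        there both sides vanish.\<close>
      proof (cases "?O = {}")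
        case True
        then have "{T. T \<subseteq> B0 \<and> card T = t \<and> cls T = i} = {}" using sub[OF B0] by blast
        then have "n i = 0" using class_count[OF B0, of i] by (metis card.empty)
        then show ?thesis unfolding True by simp
      next
        case False
        then obtain T where T: "T \<subseteq> P" "card T = t" "cls T = i" by blast
        have index: "l * (card P choose t) = card \<B> * (k choose t)"
          using design_index[OF fin _ _ l] sub card_block by blast
        have i: "card ?O * l = card \<B> * n i" using class_index[OF T(1,2)] T l by simp
        have "card \<B> * (n i * (card P choose t)) = card ?O * (l * (card P choose t))"
          by (metis (no_types) i mult.assoc)
        also have "\<dots> = card \<B> * (card ?O * (k choose t))"
          by (simp only: index mult.left_commute)
        finally have "card \<B> * (n i * (card P choose t)) = card \<B> * (card ?O * (k choose t))" .
        then show ?thesis using b by simp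
      qed
    qed
  next
    assume R: ?R
    \<comment> \<open>The size of the class cancels because \<open>T\<close> itself belongs to it;
      what remains is independent of \<open>T\<close>.\<close>
    have main: "card {B \<in> \<B>. T \<subseteq> B} * (card P choose t) = card \<B> * (k choose t)"
      if T: "T \<subseteq> P" "card T = t" for T
    proof -
      let ?O = "{S. S \<subseteq> P \<and> card S = t \<and> cls S = cls T}"
      have "finite ?O" "T \<in> ?O" using fin T by auto
      then have O: "card ?O > 0" by (auto simp: card_gt_0_iff)
      have "card ?O * (card {B \<in> \<B>. T \<subseteq> B} * (card P choose t)) = card \<B> * (n (cls T) * (card P choose t))"
        by (simp only: mult.assoc[symmetric] class_index[OF T])
      also have "\<dots> = card ?O * (card \<B> * (k choose t))" using R by (simp only: mult.left_commute)
      finally show ?thesis using O by (simp only: mult_cancel1) simp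
    qed
    \<comment> \<open>A \<open>t\<close>-set exists because \<open>t \<le> k \<le> card P\<close>;
      its covering number serves as \<open>l\<close>.\<close>
    obtain T0 where T0: "T0 \<subseteq> P" "card T0 = t"
      using tk kv obtain_subset_with_card_n[of t P] by auto
    have "card {B \<in> \<B>. T0 \<subseteq> B} > 0" using main[OF T0] b pos by (intro gr0I) simp
    moreover have "card {B \<in> \<B>. T \<subseteq> B} = card {B \<in> \<B>. T0 \<subseteq> B}" if "T \<subseteq> P \<and> card T = t" for T
    proof -
      have "card {B \<in> \<B>. T \<subseteq> B} * (card P choose t) = card {B \<in> \<B>. T0 \<subseteq> B} * (card P choose t)"
        using main[of T] main[OF T0] that by (simp only:)
      then show ?thesis using pos by (simp only: mult_cancel2) simp
    qed
    ultimately show ?L by blast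
  qed
qed

end

section \<open>Collinear sets in a square grid\<close>

definition grid :: "nat \<Rightarrow> (nat \<times> nat) set" where
  "grid m = {1..m} \<times> {1..m}"

text \<open>Adjacency in the rook's graph, that is, in the line graph of the complete bipartite
  graph, made reflexive.\<close>

definition same_line :: "nat \<times> nat \<Rightarrow> nat \<times> nat \<Rightarrow> bool" where
  "same_line x y \<longleftrightarrow> fst x = fst y \<or> snd x = snd y"

text \<open>The empty set and singletons count as collinear, so the counts below require at least
  two cells.\<close>

definition collinear :: "(nat \<times> nat) set \<Rightarrow> bool" where
  "collinear F \<longleftrightarrow> (\<exists>i. fst ` F \<subseteq> {i}) \<or> (\<exists>j. snd ` F \<subseteq> {j})"

definition collinear_subsets :: "nat \<Rightarrow> (nat \<times> nat) set \<Rightarrow> (nat \<times> nat) set set" where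
  "collinear_subsets t A = {F. F \<subseteq> A \<and> card F = t \<and> collinear F}"

text \<open>The number of edges that \<open>T\<close> induces in the rook's graph. On triples its
  values 0, 1, 2, 3 separate the orbits of \<open>G\<close>.\<close>

definition pair_count :: "(nat \<times> nat) set \<Rightarrow> nat" where
  "pair_count T = card (collinear_subsets 2 T)"

text \<open>The middle cell \<open>(a, c)\<close> is where the row pair and the column pair meet; it
  is the middle edge of the corresponding 3-path.\<close>

definition corners :: "(nat \<times> nat) set \<Rightarrow> (nat \<times> nat) set set" where
  "corners A = {T. T \<subseteq> A \<and> (\<exists>a b c d. a \<noteq> d \<and> b \<noteq> c \<and> T = {(a, b), (a, c), (d, c)})}"

lemma finite_grid [simp]: "finite (grid m)"
  by (simp add: grid_def)

lemma finite_subset_grid: "A \<subseteq> grid m \<Longrightarrow> finite A"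
  using finite_subset finite_grid by blast

lemma card_grid: "card (grid m) = m\<^sup>2"
  by (simp add: grid_def power2_eq_square)

lemma same_line_sym: "same_line x y \<longleftrightarrow> same_line y x"
  by (auto simp: same_line_def)

lemma collinear_pair: "collinear {x, y} \<longleftrightarrow> same_line x y"
  by (auto simp: collinear_def same_line_def)

text \<open>Pairwise collinearity suffices: if two of the cells share a row with the first and a
  column with it respectively, they share no line with each other.\<close>

lemma collinear_triple:
  assumes "distinct [x, y, z]"
  shows "collinear {x, y, z} \<longleftrightarrow> same_line x y \<and> same_line x z \<and> same_line y z"
  using assms by (cases x; cases y; cases z) (auto simp: collinear_def same_line_def)

lemma collinear_image_bij:
  assumes "\<And>x y. same_line (g x) (g y) \<longleftrightarrow> same_line x y" "inj g" "card F = 2"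
  shows "collinear (g ` F) \<longleftrightarrow> collinear F"
  using assms by (auto simp: card_2_iff collinear_pair)

lemma finite_collinear_subsets: "finite A \<Longrightarrow> finite (collinear_subsets t A)"
  by (rule finite_subset[of _ "Pow A"]) (auto simp: collinear_subsets_def)

lemma collinear_subsets_2_triple:
  assumes "distinct [x, y, z]"
  shows "collinear_subsets 2 {x, y, z} =
    (if same_line x y then {{x, y}} else {}) \<union> (if same_line x z then {{x, z}} else {})
      \<union> (if same_line y z then {{y, z}} else {})" (is "_ = ?R")
proof (intro equalityI subsetI)
  fix F assume "F \<in> collinear_subsets 2 {x, y, z}"
  then have F: "F \<subseteq> {x, y, z}" "card F = 2" "collinear F" by (auto simp: collinear_subsets_def)
  obtain u v where uv: "F = {u, v}" "u \<noteq> v" using F(2) unfolding card_2_iff by blast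
  have "same_line u v" "u \<in> {x, y, z}" "v \<in> {x, y, z}"
    using F(1,3) by (auto simp: uv collinear_pair)
  then show "F \<in> ?R" using uv(2) unfolding uv(1)
    by (elim insertE emptyE) (simp_all add: same_line_sym insert_commute)
next
  fix F assume "F \<in> ?R"
  then consider "F = {x, y}" "same_line x y" | "F = {x, z}" "same_line x z" | "F = {y, z}" "same_line y z"
    by (auto split: if_splits)
  then show "F \<in> collinear_subsets 2 {x, y, z}"
    using assms by cases (simp_all add: collinear_subsets_def collinear_pair)
qed

lemma pair_count_triple:
  assumes "distinct [x, y, z]"
  shows "pair_count {x, y, z} =
    of_bool (same_line x y) + of_bool (same_line x z) + of_bool (same_line y z)"
  using assms unfolding pair_count_def collinear_subsets_2_triple[OF assms]
  by (auto simp: card_insert_if doubleton_eq_iff)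

lemma card_3_cases:
  assumes "card T = 3"
  obtains x y z where "T = {x, y, z}" "distinct [x, y, z]"
  using assms by (auto simp: card_3_iff)

lemma pair_count_le_3:
  assumes "card T = 3"
  shows "pair_count T \<le> 3"
proof -
  obtain x y z where xyz: "T = {x, y, z}" "distinct [x, y, z]"
    using assms by (rule card_3_cases)
  show ?thesis unfolding xyz(1) pair_count_triple[OF xyz(2)] by (simp add: of_bool_def)
qed

lemma collinear_iff_pair_count:
  assumes "card T = 3"
  shows "collinear T \<longleftrightarrow> pair_count T = 3"
proof -
  obtain x y z where xyz: "T = {x, y, z}" "distinct [x, y, z]"
    using assms by (rule card_3_cases)
  show ?thesis
    unfolding xyz(1) collinear_triple[OF xyz(2)] pair_count_triple[OF xyz(2)] by (simp add: of_bool_def)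
qed

lemma collinear_subsets_3:
  "collinear_subsets 3 A = {T. T \<subseteq> A \<and> card T = 3 \<and> pair_count T = 3}"
  unfolding collinear_subsets_def using collinear_iff_pair_count by blast

text \<open>Two collinear pairs of a triple share a cell. One lies in a row and the other in a
  column, since two in the same direction would make the third pair collinear as well.\<close>

lemma corners_eq:
  "corners A = {T. T \<subseteq> A \<and> card T = 3 \<and> pair_count T = 2}"
proof (intro equalityI subsetI)
  fix T assume "T \<in> corners A"
  then obtain a b c d where T: "T \<subseteq> A" "a \<noteq> d" "b \<noteq> c" "T = {(a, b), (a, c), (d, c)}"
    by (auto simp: corners_def)
  then show "T \<in> {T. T \<subseteq> A \<and> card T = 3 \<and> pair_count T = 2}"
    by (auto simp: pair_count_triple same_line_def)
next
  \<comment> \<open>Here \<open>(a, b)\<close> is the cell common to the two collinear pairs; the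
    two cases say which of the other cells lies in its row.\<close>
  have corner: "{(a, b), (a', b'), (a'', b'')} \<in> corners A"
    if "same_line (a, b) (a', b')" "same_line (a, b) (a'', b'')" "\<not> same_line (a', b') (a'', b'')"
      "(a, b) \<noteq> (a', b')" "(a, b) \<noteq> (a'', b'')"
      "{(a, b), (a', b'), (a'', b'')} \<subseteq> A" for a b a' b' a'' b''
  proof -
    have "(a' = a \<and> b'' = b) \<or> (a'' = a \<and> b' = b)" using that by (auto simp: same_line_def)
    then show ?thesis
    proof
      assume c: "a' = a \<and> b'' = b"
      have "{(a, b), (a', b'), (a'', b'')} = {(a, b'), (a, b), (a'', b)}" using c by auto
      moreover have "a \<noteq> a''" "b' \<noteq> b" using that(4,5) c by auto
      ultimately show ?thesis unfolding corners_def using that(6) by blast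
    next
      assume c: "a'' = a \<and> b' = b"
      have "{(a, b), (a', b'), (a'', b'')} = {(a, b''), (a, b), (a', b)}" using c by auto
      moreover have "a \<noteq> a'" "b'' \<noteq> b" using that(4,5) c by auto
      ultimately show ?thesis unfolding corners_def using that(6) by blast
    qed
  qed
  fix T assume "T \<in> {T. T \<subseteq> A \<and> card T = 3 \<and> pair_count T = 2}"
  then have T: "T \<subseteq> A" "card T = 3" "pair_count T = 2" by auto
  obtain x y z where xyz: "T = {x, y, z}" "distinct [x, y, z]" using T(2) by (rule card_3_cases)
  then have "of_bool (same_line x y) + of_bool (same_line x z) + of_bool (same_line y z) = (2::nat)"
    using T(3) by (simp only: pair_count_triple)
  then consider "same_line x y" "same_line x z" "\<not> same_line y z"
    | "same_line y x" "same_line y z" "\<not> same_line x z"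
    | "same_line z x" "same_line z y" "\<not> same_line x y"
    by (auto simp: same_line_sym of_bool_def split: if_splits)
  then show "T \<in> corners A"
  proof cases
    case 1
    then show ?thesis
      using corner[of "fst x" "snd x" "fst y" "snd y" "fst z" "snd z"] T(1) xyz by simp
  next
    case 2
    then show ?thesis
      using corner[of "fst y" "snd y" "fst x" "snd x" "fst z" "snd z"] T(1) xyz
      by (auto simp: insert_commute)
  next
    case 3
    then show ?thesis
      using corner[of "fst z" "snd z" "fst x" "snd x" "fst y" "snd y"] T(1) xyz
      by (auto simp: insert_commute)
  qed
qed

section \<open>Counting collinear sets and corners\<close>

definition row_degree :: "(nat \<times> nat) set \<Rightarrow> nat \<Rightarrow> nat" where
  "row_degree A i = card {e \<in> A. fst e = i}"

definition col_degree :: "(nat \<times> nat) set \<Rightarrow> nat \<Rightarrow> nat" where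
  "col_degree A j = card {e \<in> A. snd e = j}"

text \<open>The collinear \<open>t\<close>-sets are sorted by the line that contains them. For
  \<open>2 \<le> t\<close> this line is unique: parallel lines are disjoint, and a row and a column
  share at most one cell.\<close>

lemma card_collinear_subsets:
  assumes A: "A \<subseteq> grid m" and t: "2 \<le> t"
  shows "card (collinear_subsets t A) =
    (\<Sum>i=1..m. row_degree A i choose t) + (\<Sum>j=1..m. col_degree A j choose t)"
proof -
  have finA: "finite A" using A by (rule finite_subset_grid)
  \<comment> \<open>\<open>L fst\<close> collects the \<open>t\<close>-sets inside a row,
    \<open>L snd\<close> those inside a column.\<close>
  define L where "L f = (\<Union>i\<in>{1..m}. {F. F \<subseteq> {e \<in> A. f e = i} \<and> card F = t})"
    for f :: "nat \<times> nat \<Rightarrow> nat"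
  have cardL: "card (L f) = (\<Sum>i=1..m. card {e \<in> A. f e = i} choose t)" for f
  proof -
    have "card (L f) = (\<Sum>i=1..m. card {F. F \<subseteq> {e \<in> A. f e = i} \<and> card F = t})"
      unfolding L_def
    proof (rule card_UN_disjoint)
      show "\<forall>i\<in>{1..m}. finite {F. F \<subseteq> {e \<in> A. f e = i} \<and> card F = t}" using finA by auto
      have "F = {}" if "F \<subseteq> {e \<in> A. f e = i}" "F \<subseteq> {e \<in> A. f e = j}" "i \<noteq> j" for F i j
        using that by auto
      then have "F \<notin> {F. F \<subseteq> {e \<in> A. f e = j} \<and> card F = t}"
        if "i \<noteq> j" "F \<in> {F. F \<subseteq> {e \<in> A. f e = i} \<and> card F = t}" for F i j
        using that t by (metis (mono_tags, lifting) card.empty mem_Collect_eq not_numeral_le_zero)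
      then show "\<forall>i\<in>{1..m}. \<forall>j\<in>{1..m}. i \<noteq> j \<longrightarrow> {F. F \<subseteq> {e \<in> A. f e = i} \<and> card F = t}
          \<inter> {F. F \<subseteq> {e \<in> A. f e = j} \<and> card F = t} = {}"
        by blast
    qed auto
    then show ?thesis using finA by (simp add: n_subsets)
  qed
  have ne: "F \<noteq> {}" if "card F = t" for F :: "(nat \<times> nat) set" using that t by auto
  have "collinear_subsets t A = L fst \<union> L snd"
  proof (intro equalityI subsetI)
    fix F assume F: "F \<in> collinear_subsets t A"
    then obtain e where e: "e \<in> F" using ne by (force simp: collinear_subsets_def)
    have "fst e \<in> {1..m}" "snd e \<in> {1..m}" using e F A by (auto simp: collinear_subsets_def grid_def)
    moreover have "F \<subseteq> {e' \<in> A. fst e' = fst e} \<or> F \<subseteq> {e' \<in> A. snd e' = snd e}"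
      using F e by (auto simp: collinear_subsets_def collinear_def)
    ultimately show "F \<in> L fst \<union> L snd" using F by (auto simp: L_def collinear_subsets_def)
  next
    fix F assume "F \<in> L fst \<union> L snd"
    then show "F \<in> collinear_subsets t A"
      by (fastforce simp: L_def collinear_subsets_def collinear_def)
  qed
  moreover have "L fst \<inter> L snd = {}"
  proof -
    have False if F: "F \<in> L fst" "F \<in> L snd" for F
    proof -
      obtain i j where "F \<subseteq> {(i, j)}" using F by (fastforce simp: L_def)
      then have "card F \<le> 1" using card_mono[of "{(i,j)}" F] by simp
      then show False using F t by (auto simp: L_def)
    qed
    then show ?thesis by blast
  qed
  moreover have "finite (L f)" for f using finA by (auto simp: L_def)
  ultimately show ?thesis by (simp add: card_Un_disjoint cardL row_degree_def col_degree_def)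
qed

lemma row_degree_grid: "i \<in> {1..m} \<Longrightarrow> row_degree (grid m) i = m"
proof -
  assume "i \<in> {1..m}"
  then have "{e \<in> grid m. fst e = i} = Pair i ` {1..m}" by (auto simp: grid_def)
  then show ?thesis by (simp add: row_degree_def card_image inj_on_def)
qed

lemma col_degree_grid: "j \<in> {1..m} \<Longrightarrow> col_degree (grid m) j = m"
proof -
  assume "j \<in> {1..m}"
  then have "{e \<in> grid m. snd e = j} = (\<lambda>i. (i, j)) ` {1..m}" by (auto simp: grid_def)
  then show ?thesis by (simp add: col_degree_def card_image inj_on_def)
qed

lemma card_collinear_subsets_grid:
  "2 \<le> t \<Longrightarrow> card (collinear_subsets t (grid m)) = 2 * m * (m choose t)"
  using card_collinear_subsets[of "grid m" m t] by (simp add: row_degree_grid col_degree_grid)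

text \<open>A corner corresponds to an ordered pair \<open>(a, d)\<close> of distinct rows and an
  ordered pair \<open>(c, b)\<close> of distinct columns, each starting with the line through the
  centre \<open>(a, c)\<close>. This leaves \<open>m (m - 1)\<close> choices for each pair.\<close>

lemma card_corners_grid: "card (corners (grid m)) = m\<^sup>2 * (m - 1)\<^sup>2"
proof -
  let ?I = "SIGMA (a, d) : (SIGMA a : {1..m}. {1..m} - {a}). (SIGMA c : {1..m}. {1..m} - {c})"
  let ?f = "\<lambda>((a, d), (c, b)). {(a, b), (a, c), (d, c)}"
  have "bij_betw ?f ?I (corners (grid m))"
    unfolding bij_betw_def
  proof
    have corner_inj: "a = a' \<and> d = d' \<and> c = c' \<and> b = b'"
      if ne: "d \<noteq> a" "b \<noteq> c" "d' \<noteq> a'" "b' \<noteq> c'"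
        and eq: "{(a, b), (a, c), (d, c)} = {(a', b'), (a', c'), (d', c')}"
      for a d c b a' d' c' b' :: nat
    proof -
      \<comment> \<open>The centre is the only cell of a corner that shares a line with both others,
        so the set alone determines it.\<close>
      have centre: "(p, q) = (r, s)" if "p \<noteq> u" "q \<noteq> v" "{(p, v), (p, q), (u, q)} = {(r, w), (r, s), (x, s)}"
          "r \<noteq> x" "s \<noteq> w" for p q r s u v w x :: nat
        using that by (auto simp: set_eq_iff) metis+
      have "a = a'" "c = c'" using centre[of a d c b a' b' c' d'] ne eq by auto
      moreover have "(a, b) \<in> {(a', b'), (a', c'), (d', c')}" "(d, c) \<in> {(a', b'), (a', c'), (d', c')}"
        unfolding eq[symmetric] by simp_all
      ultimately show ?thesis using ne by simp
    qed
    show "inj_on ?f ?I"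
    proof (rule inj_onI)
      fix u v assume uv: "u \<in> ?I" "v \<in> ?I" "?f u = ?f v"
      obtain a d c b where u: "u = ((a, d), (c, b))" by (metis prod.exhaust)
      obtain a' d' c' b' where v: "v = ((a', d'), (c', b'))" by (metis prod.exhaust)
      show "u = v" using corner_inj[of d a b c d' a' b' c'] uv unfolding u v by simp
    qed
    show "?f ` ?I = corners (grid m)"
    proof (intro equalityI subsetI)
      fix T assume "T \<in> ?f ` ?I"
      then obtain a d c b where T: "T = {(a, b), (a, c), (d, c)}" "a \<noteq> d" "b \<noteq> c"
        and "{a, b, c, d} \<subseteq> {1..m}" by force
      then have "T \<subseteq> grid m" by (simp add: grid_def)
      with T show "T \<in> corners (grid m)" unfolding corners_def by blast
    next
      fix T assume "T \<in> corners (grid m)"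
      then obtain a b c d where "T \<subseteq> grid m" "a \<noteq> d" "b \<noteq> c" "T = {(a, b), (a, c), (d, c)}"
        unfolding corners_def by blast
      moreover from this have "((a, d), (c, b)) \<in> ?I" by (auto simp: grid_def)
      ultimately show "T \<in> ?f ` ?I"
        by (intro image_eqI[of _ _ "((a, d), (c, b))"]) simp_all
    qed
  qed
  then have "card (corners (grid m)) = card ?I" by (simp add: bij_betw_same_card)
  also have "\<dots> = m * (m - 1) * (m * (m - 1))" by (simp add: card_SigmaI case_prod_unfold)
  finally show ?thesis by (simp add: power2_eq_square algebra_simps)
qed

text \<open>Both sides count the pairs consisting of a collinear pair and a further element of \<open>A\<close>.\<close>

lemma pair_count_sum:
  assumes A: "finite A"
  shows "card (collinear_subsets 2 A) * (card A - 2) =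
    (\<Sum>i\<le>3. i * card {T. T \<subseteq> A \<and> card T = 3 \<and> pair_count T = i})"
proof -
  let ?S = "{T. T \<subseteq> A \<and> card T = 3}"
  have finS: "finite ?S" using A by auto
  have "(\<Sum>F\<in>collinear_subsets 2 A. card {T \<in> ?S. F \<subseteq> T}) = (\<Sum>T\<in>?S. pair_count T)"
  proof (rule sum_multicount_gen)
    show "\<forall>T\<in>?S. card {F \<in> collinear_subsets 2 A. F \<subseteq> T} = pair_count T"
    proof
      fix T assume "T \<in> ?S"
      then have "{F \<in> collinear_subsets 2 A. F \<subseteq> T} = collinear_subsets 2 T"
        by (auto simp: collinear_subsets_def)
      then show "card {F \<in> collinear_subsets 2 A. F \<subseteq> T} = pair_count T"
        by (simp add: pair_count_def)
    qed
  qed (use A finS finite_collinear_subsets in auto)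
  moreover have "card {T \<in> ?S. F \<subseteq> T} = card A - 2" if "F \<in> collinear_subsets 2 A" for F
  proof -
    have F: "F \<subseteq> A" "card F = 2" "finite F" using that A finite_subset by (auto simp: collinear_subsets_def)
    have "{T \<in> ?S. F \<subseteq> T} = (\<lambda>e. insert e F) ` (A - F)"
    proof (intro equalityI subsetI)
      fix T assume T: "T \<in> {T \<in> ?S. F \<subseteq> T}"
      then have "finite T" using A finite_subset by auto
      then have "card (T - F) = 1" using T F by (simp add: card_Diff_subset)
      then obtain e where "T - F = {e}" by (rule card_1_singletonE)
      then show "T \<in> (\<lambda>e. insert e F) ` (A - F)" using T by (intro image_eqI[of _ _ e]) auto
    next
      fix T assume "T \<in> (\<lambda>e. insert e F) ` (A - F)"
      then show "T \<in> {T \<in> ?S. F \<subseteq> T}" using F by auto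
    qed
    moreover have "inj_on (\<lambda>e. insert e F) (A - F)" by (auto simp: inj_on_def)
    ultimately show ?thesis using F by (simp add: card_image card_Diff_subset)
  qed
  ultimately have "card (collinear_subsets 2 A) * (card A - 2) = (\<Sum>T\<in>?S. pair_count T)" by simp
  also have "\<dots> = (\<Sum>i\<le>3. \<Sum>T\<in>{T \<in> ?S. pair_count T = i}. pair_count T)"
    using finS pair_count_le_3 by (intro sum.group[symmetric]) auto
  also have "\<dots> = (\<Sum>i\<le>3. i * card {T \<in> ?S. pair_count T = i})"
    by (intro sum.cong) auto
  finally show ?thesis by (simp add: conj_assoc)
qed

section \<open>The orbit of a grid subset\<close>

text \<open>Induction on the lists: a permutation \<open>p\<close> for the tails is followed by the
  transposition of \<open>p x\<close> and \<open>y\<close>. By distinctness neither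
  \<open>p x\<close> nor \<open>y\<close> is the image of a tail entry, so the entries already
  placed stay fixed.\<close>

lemma permutes_extending_list:
  assumes "length xs = length ys" "distinct xs" "distinct ys" "set xs \<subseteq> S" "set ys \<subseteq> S"
  shows "\<exists>p. p permutes S \<and> map p xs = ys"
  using assms
proof (induction xs ys rule: list_induct2)
  case Nil
  then show ?case by (auto intro: permutes_id)
next
  case (Cons x xs y ys)
  then obtain p where p: "p permutes S" "map p xs = ys" by auto
  let ?p = "transpose (p x) y \<circ> p"
  have "p x \<in> S" using Cons.prems p permutes_in_image by fastforce
  then have perm: "?p permutes S"
    using Cons.prems p by (intro permutes_compose permutes_swap_id) auto
  have "?p z = p z" if "z \<in> set xs" for z
  proof -
    have "p z \<noteq> p x" using that Cons.prems injD[OF permutes_inj[OF p(1)], of z x] by auto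
    moreover have "p z \<noteq> y" using that Cons.prems p(2) by auto
    ultimately show ?thesis by (simp add: transpose_def)
  qed
  then have "map ?p (x # xs) = y # ys" using p(2) by auto
  with perm show ?case by (intro exI conjI)
qed

text \<open>Only row and column permutations act, so this is the orbit under \<open>K\<close>; the
  transposition is brought in later by a hypothesis on \<open>A\<close>.\<close>

definition grid_orbit :: "nat \<Rightarrow> (nat \<times> nat) set \<Rightarrow> (nat \<times> nat) set set" where
  "grid_orbit m A = {map_prod p q ` A | p q. p permutes {1..m} \<and> q permutes {1..m}}"

lemma grid_orbit_self: "A \<in> grid_orbit m A"
proof -
  have "map_prod id id ` A = A" by (simp add: map_prod.id)
  then show ?thesis unfolding grid_orbit_def using permutes_id by blast
qed

lemma inj_map_prod_permutes: "p permutes S \<Longrightarrow> q permutes S' \<Longrightarrow> inj (map_prod p q)"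
  by (intro prod.inj_map permutes_inj)

lemma map_prod_grid:
  "p permutes {1..m} \<Longrightarrow> q permutes {1..m} \<Longrightarrow> map_prod p q ` grid m = grid m"
  unfolding grid_def by (intro map_prod_surj_on permutes_image)

lemma same_line_map_prod:
  assumes "p permutes S" "q permutes S'"
  shows "same_line (map_prod p q x) (map_prod p q y) \<longleftrightarrow> same_line x y"
  using assms by (cases x; cases y) (auto simp: same_line_def dest: permutes_inj injD)

lemma collinear_subsets_2_image:
  assumes "\<And>x y. same_line (g x) (g y) \<longleftrightarrow> same_line x y" "inj g"
  shows "collinear_subsets 2 (g ` A) = (`) g ` collinear_subsets 2 A"
proof (intro equalityI subsetI)
  fix F assume F: "F \<in> collinear_subsets 2 (g ` A)"
  then obtain F' where F': "F' \<subseteq> A" "F = g ` F'" by (auto simp: collinear_subsets_def subset_image_iff)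
  then have "card F' = 2" using F assms(2) by (simp add: collinear_subsets_def card_image inj_on_subset)
  then have "F' \<in> collinear_subsets 2 A"
    using F F' collinear_image_bij[OF assms] by (simp add: collinear_subsets_def)
  then show "F \<in> (`) g ` collinear_subsets 2 A" using F'(2) by blast
next
  fix F assume "F \<in> (`) g ` collinear_subsets 2 A"
  then obtain F' where "F' \<in> collinear_subsets 2 A" "F = g ` F'" by blast
  then show "F \<in> collinear_subsets 2 (g ` A)"
    using collinear_image_bij[OF assms] assms(2)
    by (auto simp: collinear_subsets_def card_image inj_on_subset)
qed

lemma inj_image_sets: "inj g \<Longrightarrow> inj_on ((`) g) X"
  by (auto simp: inj_on_def inj_image_eq_iff)

lemma pair_count_image:
  assumes "\<And>x y. same_line (g x) (g y) \<longleftrightarrow> same_line x y" "inj g"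
  shows "pair_count (g ` A) = pair_count A"
  unfolding pair_count_def collinear_subsets_2_image[OF assms]
  by (simp add: card_image inj_image_sets[OF assms(2)])

lemma grid_orbit_subset: "A \<subseteq> grid m \<Longrightarrow> B \<in> grid_orbit m A \<Longrightarrow> B \<subseteq> grid m"
  unfolding grid_orbit_def using map_prod_grid by blast

lemma finite_grid_orbit: "A \<subseteq> grid m \<Longrightarrow> finite (grid_orbit m A)"
  by (rule finite_subset[of _ "Pow (grid m)"]) (auto dest: grid_orbit_subset)

lemma grid_orbit_card:
  assumes "B \<in> grid_orbit m A" shows "card B = card A"
proof -
  obtain p q where "p permutes {1..m}" "q permutes {1..m}" "B = map_prod p q ` A"
    using assms by (auto simp: grid_orbit_def)
  then show ?thesis
    using card_image[OF inj_on_subset[OF inj_map_prod_permutes subset_UNIV]] by blast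
qed

lemma card_classes_image:
  assumes "inj g" "\<And>T. T \<subseteq> A \<Longrightarrow> card T = t \<Longrightarrow> cls (g ` T) = cls T"
  shows "card {T. T \<subseteq> g ` A \<and> card T = t \<and> cls T = i} = card {T. T \<subseteq> A \<and> card T = t \<and> cls T = i}"
proof -
  have "{T. T \<subseteq> g ` A \<and> card T = t \<and> cls T = i} = (`) g ` {T. T \<subseteq> A \<and> card T = t \<and> cls T = i}"
  proof (intro equalityI subsetI)
    fix T assume T: "T \<in> {T. T \<subseteq> g ` A \<and> card T = t \<and> cls T = i}"
    then obtain T' where T': "T' \<subseteq> A" "T = g ` T'" by (auto simp: subset_image_iff)
    then have "card T' = t" using T assms(1) by (simp add: card_image inj_on_subset)
    then show "T \<in> (`) g ` {T. T \<subseteq> A \<and> card T = t \<and> cls T = i}"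
      using T T' assms(2)[OF T'(1)] by auto
  next
    fix T assume "T \<in> (`) g ` {T. T \<subseteq> A \<and> card T = t \<and> cls T = i}"
    then obtain T' where "T' \<subseteq> A" "card T' = t" "cls T' = i" "T = g ` T'" by blast
    then show "T \<in> {T. T \<subseteq> g ` A \<and> card T = t \<and> cls T = i}"
      using assms by (auto simp: card_image inj_on_subset)
  qed
  then show ?thesis by (simp add: card_image inj_image_sets[OF assms(1)])
qed

lemma card_covering_image:
  assumes "finite \<B>" "inj g" "\<And>B. B \<in> \<B> \<Longrightarrow> g ` B \<in> \<B>"
  shows "card {B \<in> \<B>. g ` T \<subseteq> B} = card {B \<in> \<B>. T \<subseteq> B}"
proof -
  have "(`) g ` \<B> = \<B>"
    using assms by (intro endo_inj_surj inj_image_sets) auto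
  then have "{B \<in> \<B>. g ` T \<subseteq> B} = {B \<in> (`) g ` \<B>. g ` T \<subseteq> B}" by simp
  also have "\<dots> = (`) g ` {B \<in> \<B>. T \<subseteq> B}"
    using inj_image_subset_iff[OF assms(2)] by blast
  finally show ?thesis by (simp add: card_image inj_image_sets[OF assms(2)])
qed

text \<open>\<open>transpose_orbit\<close> expresses the hypothesis on \<tau> in terms of cells. The
  bound \<open>3 \<le> m\<close> leaves room for three distinct indices in the orbit
  representatives; in the final theorem it is derived from the bounds on \<open>k\<close>.\<close>

locale self_transpose =
  fixes m :: nat and A :: "(nat \<times> nat) set"
  assumes m3: "3 \<le> m" and A_grid: "A \<subseteq> grid m" and A_card: "3 \<le> card A"
    and transpose_orbit: "prod.swap ` A \<in> grid_orbit m A"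
begin

definition cov :: "(nat \<times> nat) set \<Rightarrow> nat" where
  "cov T = card {B \<in> grid_orbit m A. T \<subseteq> B}"

lemma orbit_map_prod:
  assumes "B \<in> grid_orbit m A" "p permutes {1..m}" "q permutes {1..m}"
  shows "map_prod p q ` B \<in> grid_orbit m A"
proof -
  obtain p' q' where B: "p' permutes {1..m}" "q' permutes {1..m}" "B = map_prod p' q' ` A"
    using assms(1) by (auto simp: grid_orbit_def)
  have "map_prod p q ` B = map_prod (p \<circ> p') (q \<circ> q') ` A"
    by (simp add: B(3) image_comp map_prod.comp)
  then show ?thesis
    unfolding grid_orbit_def using permutes_compose B assms by blast
qed

text \<open>Transposition carries \<open>map_prod p q\<close> to \<open>map_prod q p\<close>, so the
  transpose of any block is an image of the transpose of \<open>A\<close>, which lies in the orbit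
  by assumption.\<close>

lemma orbit_swap:
  assumes "B \<in> grid_orbit m A"
  shows "prod.swap ` B \<in> grid_orbit m A"
proof -
  obtain p q where B: "p permutes {1..m}" "q permutes {1..m}" "B = map_prod p q ` A"
    using assms by (auto simp: grid_orbit_def)
  obtain p' q' where A: "p' permutes {1..m}" "q' permutes {1..m}" "prod.swap ` A = map_prod p' q' ` A"
    using transpose_orbit by (auto simp: grid_orbit_def)
  have "prod.swap ` B = map_prod q p ` prod.swap ` A"
    unfolding B(3) image_image by (simp add: prod.swap_def map_prod_def case_prod_unfold)
  also have "\<dots> = map_prod (q \<circ> p') (p \<circ> q') ` A"
    by (simp add: A(3) image_comp map_prod.comp)
  finally show ?thesis
    unfolding grid_orbit_def using permutes_compose A B by blast
qed

lemma cov_map_prod: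
  assumes "p permutes {1..m}" "q permutes {1..m}"
  shows "cov (map_prod p q ` T) = cov T"
  unfolding cov_def
  by (rule card_covering_image)
    (use assms finite_grid_orbit A_grid inj_map_prod_permutes orbit_map_prod in auto)

text \<open>This reduces every configuration along a column to the corresponding one along a
  row.\<close>

lemma cov_swap: "cov (prod.swap ` T) = cov T"
  unfolding cov_def
  by (rule card_covering_image) (use finite_grid_orbit A_grid orbit_swap in auto)

section \<open>Covering numbers of pairs and triples through representatives\<close>

lemma extend_single: "a \<in> {1..m} \<Longrightarrow> \<exists>p. p permutes {1..m} \<and> p 1 = a"
  using permutes_extending_list[of "[1]" "[a]" "{1..m}"] m3 by auto

lemma extend_triple:
  assumes "distinct [a, b, c]" "a \<in> {1..m}" "b \<in> {1..m}" "c \<in> {1..m}"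
  shows "\<exists>p. p permutes {1..m} \<and> p 1 = a \<and> p 2 = b \<and> p 3 = c"
  using permutes_extending_list[of "[1, 2, 3]" "[a, b, c]" "{1..m}"] assms m3 by auto

lemma extend_pair:
  assumes "a \<noteq> b" "a \<in> {1..m}" "b \<in> {1..m}"
  shows "\<exists>p. p permutes {1..m} \<and> p 1 = a \<and> p 2 = b"
  using permutes_extending_list[of "[1, 2]" "[a, b]" "{1..m}"] assms m3 by auto

text \<open>Suitable permutations of rows and columns carry a representative with indices from 1, 2,
  3 to the given cells. The lemmas on the other configurations follow the same pattern.\<close>

lemma cov_row_pair:
  assumes "b \<noteq> c" "(a, b) \<in> grid m" "(a, c) \<in> grid m"
  shows "cov {(a, b), (a, c)} = cov {(1, 1), (1, 2)}"
proof -
  obtain p where p: "p permutes {1..m}" "p 1 = a"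
    using extend_single assms unfolding grid_def mem_Times_iff fst_conv snd_conv by blast
  obtain q where q: "q permutes {1..m}" "q 1 = b" "q 2 = c"
    using extend_pair assms unfolding grid_def mem_Times_iff fst_conv snd_conv by blast
  show ?thesis using cov_map_prod[OF p(1) q(1), of "{(1, 1), (1, 2)}"] p q by simp
qed

lemma cov_general_pair:
  assumes "a \<noteq> c" "b \<noteq> d" "(a, b) \<in> grid m" "(c, d) \<in> grid m"
  shows "cov {(a, b), (c, d)} = cov {(1, 1), (2, 2)}"
proof -
  obtain p where p: "p permutes {1..m}" "p 1 = a" "p 2 = c"
    using extend_pair assms unfolding grid_def mem_Times_iff fst_conv snd_conv by blast
  obtain q where q: "q permutes {1..m}" "q 1 = b" "q 2 = d"
    using extend_pair assms unfolding grid_def mem_Times_iff fst_conv snd_conv by blast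
  show ?thesis using cov_map_prod[OF p(1) q(1), of "{(1, 1), (2, 2)}"] p q by simp
qed

lemma cov_row_triple:
  assumes "distinct [b, c, d]" "(a, b) \<in> grid m" "(a, c) \<in> grid m" "(a, d) \<in> grid m"
  shows "cov {(a, b), (a, c), (a, d)} = cov {(1, 1), (1, 2), (1, 3)}"
proof -
  obtain p where p: "p permutes {1..m}" "p 1 = a"
    using extend_single assms unfolding grid_def mem_Times_iff fst_conv snd_conv by blast
  obtain q where q: "q permutes {1..m}" "q 1 = b" "q 2 = c" "q 3 = d"
    using extend_triple[of b c d] assms unfolding grid_def mem_Times_iff fst_conv snd_conv by blast
  show ?thesis using cov_map_prod[OF p(1) q(1), of "{(1, 1), (1, 2), (1, 3)}"] p q by simp
qed

lemma cov_corner: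
  assumes "a \<noteq> d" "b \<noteq> c" "(a, b) \<in> grid m" "(a, c) \<in> grid m" "(d, c) \<in> grid m"
  shows "cov {(a, b), (a, c), (d, c)} = cov {(1, 1), (1, 2), (2, 2)}"
proof -
  obtain p where p: "p permutes {1..m}" "p 1 = a" "p 2 = d"
    using extend_pair assms unfolding grid_def mem_Times_iff fst_conv snd_conv by blast
  obtain q where q: "q permutes {1..m}" "q 1 = b" "q 2 = c"
    using extend_pair assms unfolding grid_def mem_Times_iff fst_conv snd_conv by blast
  show ?thesis using cov_map_prod[OF p(1) q(1), of "{(1, 1), (1, 2), (2, 2)}"] p q by simp
qed

lemma cov_row_pair_point:
  assumes "a \<noteq> d" "distinct [b, c, e]" "(a, b) \<in> grid m" "(a, c) \<in> grid m" "(d, e) \<in> grid m"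
  shows "cov {(a, b), (a, c), (d, e)} = cov {(1, 1), (1, 2), (2, 3)}"
proof -
  obtain p where p: "p permutes {1..m}" "p 1 = a" "p 2 = d"
    using extend_pair assms unfolding grid_def mem_Times_iff fst_conv snd_conv by blast
  obtain q where q: "q permutes {1..m}" "q 1 = b" "q 2 = c" "q 3 = e"
    using extend_triple[of b c e] assms unfolding grid_def mem_Times_iff fst_conv snd_conv by blast
  show ?thesis using cov_map_prod[OF p(1) q(1), of "{(1, 1), (1, 2), (2, 3)}"] p q by simp
qed

lemma cov_general_triple:
  assumes "distinct [a, c, e]" "distinct [b, d, f]" "(a, b) \<in> grid m" "(c, d) \<in> grid m" "(e, f) \<in> grid m"
  shows "cov {(a, b), (c, d), (e, f)} = cov {(1, 1), (2, 2), (3, 3)}"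
proof -
  obtain p where p: "p permutes {1..m}" "p 1 = a" "p 2 = c" "p 3 = e"
    using extend_triple[of a c e] assms unfolding grid_def mem_Times_iff fst_conv snd_conv by blast
  obtain q where q: "q permutes {1..m}" "q 1 = b" "q 2 = d" "q 3 = f"
    using extend_triple[of b d f] assms unfolding grid_def mem_Times_iff fst_conv snd_conv by blast
  show ?thesis using cov_map_prod[OF p(1) q(1), of "{(1, 1), (2, 2), (3, 3)}"] p q by simp
qed

lemma cov_pair:
  assumes "T \<subseteq> grid m" "card T = 2"
  shows "cov T = (if collinear T then cov {(1, 1), (1, 2)} else cov {(1, 1), (2, 2)})"
proof -
  obtain a b c d where T: "T = {(a, b), (c, d)}" "(a, b) \<noteq> (c, d)"
    using assms(2) unfolding card_2_iff by force
  then have g: "(a, b) \<in> grid m" "(c, d) \<in> grid m" using assms(1) by auto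
  then have g': "(b, a) \<in> grid m" "(d, c) \<in> grid m" by (auto simp: grid_def)
  consider "a = c" "b \<noteq> d" | "a \<noteq> c" "b = d" | "a \<noteq> c" "b \<noteq> d" using T by auto
  then show ?thesis
  proof cases
    case 1
    then show ?thesis using cov_row_pair[of b d a] g by (simp add: T(1) collinear_pair same_line_def)
  next
    \<comment> \<open>A pair in a column is the transpose of a pair in a row.\<close>
    case 2
    then show ?thesis using cov_row_pair[of a c b] cov_swap[of "{(b, a), (b, c)}"] g'
      by (simp add: T(1) collinear_pair same_line_def)
  next
    case 3
    then show ?thesis using cov_general_pair[of a c b d] g
      by (simp add: T(1) collinear_pair same_line_def)
  qed
qed

text \<open>The third cell avoids every line through the other two. If these lie in a row,
  \<open>cov_row_pair_point\<close> applies directly, otherwise after transposition.\<close>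

lemma cov_pair_point:
  assumes "distinct [x, y, z]" "{x, y, z} \<subseteq> grid m"
    and "same_line x y" "\<not> same_line x z" "\<not> same_line y z"
  shows "cov {x, y, z} = cov {(1, 1), (1, 2), (2, 3)}"
proof -
  obtain a b c d e f where xyz: "x = (a, b)" "y = (c, d)" "z = (e, f)" by (metis prod.exhaust)
  have g: "(a, b) \<in> grid m" "(c, d) \<in> grid m" "(e, f) \<in> grid m"
    "(b, a) \<in> grid m" "(d, c) \<in> grid m" "(f, e) \<in> grid m"
    using assms(2) xyz by (auto simp: grid_def)
  consider "a = c" "b \<noteq> d" | "a \<noteq> c" "b = d" using assms xyz by (auto simp: same_line_def)
  then show ?thesis
  proof cases
    case 1
    then show ?thesis using cov_row_pair_point[of a e b d f] g assms
      by (simp add: xyz same_line_def)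
  next
    case 2
    then show ?thesis
      using cov_row_pair_point[of b f a c e] cov_swap[of "{(b, a), (b, c), (f, e)}"] g assms
      by (simp add: xyz same_line_def)
  qed
qed

lemma cov_collinear_triple:
  assumes "distinct [x, y, z]" "{x, y, z} \<subseteq> grid m"
    and "same_line x y" "same_line x z" "same_line y z"
  shows "cov {x, y, z} = cov {(1, 1), (1, 2), (1, 3)}"
proof -
  obtain a b c d e f where xyz: "x = (a, b)" "y = (c, d)" "z = (e, f)" by (metis prod.exhaust)
  have g: "(a, b) \<in> grid m" "(c, d) \<in> grid m" "(e, f) \<in> grid m"
    "(b, a) \<in> grid m" "(d, c) \<in> grid m" "(f, e) \<in> grid m"
    using assms(2) xyz by (auto simp: grid_def)
  consider "a = c" "a = e" "distinct [b, d, f]" | "b = d" "b = f" "distinct [a, c, e]"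
    using assms xyz by (auto simp: same_line_def)
  then show ?thesis
  proof cases
    case 1
    then show ?thesis using cov_row_triple[of b d f a] g by (simp add: xyz)
  next
    case 2
    then show ?thesis using cov_row_triple[of a c e b] cov_swap[of "{(b, a), (b, c), (b, e)}"] g
      by (simp add: xyz)
  qed
qed

text \<open>The covering number of a triple is a function of \<open>pair_count\<close>, which is the
  constancy that the class-wise criterion asks for.\<close>

lemma cov_triple:
  assumes T: "T \<subseteq> grid m" "card T = 3"
  shows "cov T = (if pair_count T = 3 then cov {(1, 1), (1, 2), (1, 3)}
    else if pair_count T = 2 then cov {(1, 1), (1, 2), (2, 2)}
    else if pair_count T = 1 then cov {(1, 1), (1, 2), (2, 3)}
    else cov {(1, 1), (2, 2), (3, 3)})"
proof -
  obtain x y z where xyz: "T = {x, y, z}" "distinct [x, y, z]"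
    using T(2) by (rule card_3_cases)
  have perms: "{x, z, y} = {x, y, z}" "{y, z, x} = {x, y, z}"
    by (simp_all add: insert_commute)
  note pc = pair_count_triple[OF xyz(2), folded xyz(1)]
  consider "pair_count T = 3" | "pair_count T = 2" | "pair_count T = 1" | "pair_count T = 0"
    using pair_count_le_3[OF T(2)] by linarith
  then show ?thesis
  proof cases
    case 1
    then have "same_line x y" "same_line x z" "same_line y z"
      using pc by (auto simp: of_bool_def split: if_splits)
    then show ?thesis using cov_collinear_triple[OF xyz(2)] 1 T xyz(1) by simp
  next
    case 2
    \<comment> \<open>A corner has one pair in a row and one in a column, so its representative is
      reached without transposition.\<close>
    then have "T \<in> corners (grid m)" using T by (simp add: corners_eq)
    then obtain a b c d where "a \<noteq> d" "b \<noteq> c" "T = {(a, b), (a, c), (d, c)}"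
      unfolding corners_def by blast
    then show ?thesis using cov_corner[of a d b c] 2 T by simp
  next
    case 3
    then have "of_bool (same_line x y) + of_bool (same_line x z) + of_bool (same_line y z) = (1::nat)"
      using pc by (simp only:)
    then consider "same_line x y" "\<not> same_line x z" "\<not> same_line y z"
      | "same_line x z" "\<not> same_line x y" "\<not> same_line z y"
      | "same_line y z" "\<not> same_line y x" "\<not> same_line z x"
      by (auto simp: of_bool_def same_line_sym split: if_splits)
    \<comment> \<open>The three cases differ only in which two cells form the collinear pair;
      relabelling puts these first.\<close>
    then have "cov {x, y, z} = cov {(1, 1), (1, 2), (2, 3)}"
    proof cases
      case 1
      then show ?thesis using cov_pair_point[of x y z] xyz T by simp
    next
      case 2
      then show ?thesis using cov_pair_point[of x z y] xyz T unfolding perms by auto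
    next
      case 3
      then show ?thesis using cov_pair_point[of y z x] xyz T unfolding perms by auto
    qed
    then have "cov T = cov {(1, 1), (1, 2), (2, 3)}" by (simp only: xyz(1))
    then show ?thesis using 3 by simp
  next
    case 4
    then have "\<not> same_line x y" "\<not> same_line x z" "\<not> same_line y z"
      using pc by (auto simp: of_bool_def split: if_splits)
    then have "cov {x, y, z} = cov {(1, 1), (2, 2), (3, 3)}"
      using cov_general_triple[of "fst x" "fst y" "fst z" "snd x" "snd y" "snd z"] T(1)
      unfolding xyz(1) by (simp add: same_line_def)
    then show ?thesis using 4 by (simp add: xyz(1))
  qed
qed

end

section \<open>Binomial coefficients and degree sums\<close>

lemma real_choose_two: "real (n choose 2) = real n * (real n - 1) / 2"
  by (cases n) (auto simp: choose_two real_of_nat_div algebra_simps)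

lemma real_choose_three: "real (n choose 3) = real n * (real n - 1) * (real n - 2) / 6"
proof -
  have "real (n choose 3) = real n gchoose 3" by (simp add: binomial_gbinomial)
  then show ?thesis by (simp add: gbinomial_prod_rev numeral_3_eq_3 fact_numeral)
qed

text \<open>The factor \<open>m^2 (m - 1)\<close> is split off because it also divides the grid
  counts of collinear pairs, collinear triples (up to the denominator 3) and corners, and reappears
  in the order of \<open>K\<close>.\<close>

lemma real_square_choose_two:
  "real (m\<^sup>2 choose 2) = (real m)\<^sup>2 * (real m - 1) * (real m + 1) / 2"
  by (simp add: real_choose_two power2_eq_square algebra_simps)

lemma real_square_choose_three:
  "real (m\<^sup>2 choose 3) = (real m)\<^sup>2 * (real m - 1) * ((real m + 1) * ((real m)\<^sup>2 - 2)) / 6"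
  by (simp add: real_choose_three power2_eq_square algebra_simps)

lemma card_subsets_by_class:
  assumes "finite A" "\<And>T. T \<subseteq> A \<Longrightarrow> card T = t \<Longrightarrow> cls T \<le> (c::nat)"
  shows "(\<Sum>i\<le>c. card {T. T \<subseteq> A \<and> card T = t \<and> cls T = i}) = card A choose t"
proof -
  let ?S = "{T. T \<subseteq> A \<and> card T = t}"
  have "card ?S = (\<Sum>i\<le>c. card {T \<in> ?S. cls T = i})"
    using sum.group[of ?S "{..c}" cls "\<lambda>_. 1::nat", symmetric] assms by (simp add: image_subset_iff)
  then show ?thesis using n_subsets[OF assms(1), of t] by (simp add: conj_assoc)
qed

text \<open>Row \<open>i\<close> of \<open>A\<close> becomes row \<open>p i\<close> of the image
  with the same number of cells; the sum is then reindexed along \<open>p\<close>.\<close>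

lemma sum_row_degree_image:
  assumes "p permutes {1..m}" "q permutes {1..m}"
  shows "(\<Sum>i=1..m. f (row_degree (map_prod p q ` A) i)) = (\<Sum>i=1..m. f (row_degree A i))"
proof -
  have "row_degree (map_prod p q ` A) (p i) = row_degree A i" for i
  proof -
    have "{e \<in> map_prod p q ` A. fst e = p i} = map_prod p q ` {e \<in> A. fst e = i}"
      by (force simp: inj_eq[OF permutes_inj[OF assms(1)]])
    then show ?thesis
      using inj_map_prod_permutes[OF assms] unfolding row_degree_def
      by (simp add: card_image inj_on_subset)
  qed
  then have "(\<Sum>i=1..m. f (row_degree A i)) = (\<Sum>i=1..m. f (row_degree (map_prod p q ` A) (p i)))"
    by simp
  also have "\<dots> = (\<Sum>i=1..m. f (row_degree (map_prod p q ` A) i))"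
    using sum.permute[OF assms(1), of "\<lambda>i. f (row_degree (map_prod p q ` A) i)"] by (simp add: comp_def)
  finally show ?thesis ..
qed

lemma row_degree_swap: "row_degree (prod.swap ` A) i = col_degree A i"
proof -
  have "{e \<in> prod.swap ` A. fst e = i} = prod.swap ` {e \<in> A. snd e = i}" by auto
  then show ?thesis by (simp add: row_degree_def col_degree_def card_image)
qed

section \<open>Design criteria in terms of the set of cells\<close>

context self_transpose
begin

abbreviation "\<kappa> \<equiv> card A"

text \<open>The column degrees of \<open>A\<close> are the row degrees of its transpose. The
  transpose is also an image of \<open>A\<close> under row and column permutations, which only
  rearrange the row degrees.\<close>

lemma sum_degrees_eq: "(\<Sum>i=1..m. f (row_degree A i)) = (\<Sum>j=1..m. f (col_degree A j))"
proof -
  obtain p q where pq: "p permutes {1..m}" "q permutes {1..m}" "prod.swap ` A = map_prod p q ` A"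
    using transpose_orbit by (auto simp: grid_orbit_def)
  show ?thesis
    using sum_row_degree_image[OF pq(1,2), of f A] unfolding pq(3)[symmetric] by (simp add: row_degree_swap)
qed

lemma orbit_class_count:
  assumes "B \<in> grid_orbit m A"
    and "\<And>p q T. p permutes {1..m} \<Longrightarrow> q permutes {1..m} \<Longrightarrow> card T = t \<Longrightarrow>
      cls (map_prod p q ` T) = cls T"
  shows "card {T. T \<subseteq> B \<and> card T = t \<and> cls T = i} = card {T. T \<subseteq> A \<and> card T = t \<and> cls T = i}"
proof -
  obtain p q where pq: "p permutes {1..m}" "q permutes {1..m}" "B = map_prod p q ` A"
    using assms(1) by (auto simp: grid_orbit_def)
  show ?thesis unfolding pq(3)
    by (rule card_classes_image) (use pq assms(2) inj_map_prod_permutes in auto)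
qed

lemma real_v_gt: "9 \<le> (real m)\<^sup>2"
  using m3 power_mono[of 3 "real m" 2] by simp

lemma v_gt: "9 \<le> m\<^sup>2"
  using m3 power_mono[of 3 m 2] by simp

text \<open>\<open>design_iff_class_counts\<close> with the orbit as the set of blocks. The bound
  \<open>t \<le> 3\<close> ensures \<open>t \<le> \<kappa>\<close>, and invariance of
  \<open>cls\<close> gives all blocks the class counts of \<open>A\<close>.\<close>

lemma design_iff_class_counts_orbit:
  fixes cls :: "(nat \<times> nat) set \<Rightarrow> nat"
  assumes "t \<le> 3"
    and "\<And>T T'. \<lbrakk>T \<subseteq> grid m; card T = t; T' \<subseteq> grid m; card T' = t; cls T = cls T'\<rbrakk> \<Longrightarrow> cov T = cov T'"
    and "\<And>p q T. p permutes {1..m} \<Longrightarrow> q permutes {1..m} \<Longrightarrow> card T = t \<Longrightarrow>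
      cls (map_prod p q ` T) = cls T"
  shows "(\<exists>l>0. \<forall>T. T \<subseteq> grid m \<and> card T = t \<longrightarrow> cov T = l) \<longleftrightarrow>
    (\<forall>i. card {T. T \<subseteq> A \<and> card T = t \<and> cls T = i} * (m\<^sup>2 choose t) =
         card {T. T \<subseteq> grid m \<and> card T = t \<and> cls T = i} * (\<kappa> choose t))"
  unfolding cov_def card_grid[symmetric]
proof (rule design_iff_class_counts[where k = \<kappa>
      and n = "\<lambda>i. card {T. T \<subseteq> A \<and> card T = t \<and> cls T = i}"])
  show "t \<le> \<kappa>" using assms(1) A_card by simp
  show "finite (grid_orbit m A)" by (rule finite_grid_orbit[OF A_grid])
  show "grid_orbit m A \<noteq> {}" using grid_orbit_self by blast
  show "B \<subseteq> grid m" "card B = \<kappa>" if "B \<in> grid_orbit m A" for B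
    using grid_orbit_subset[OF A_grid that] grid_orbit_card[OF that] by auto
  show "card {B \<in> grid_orbit m A. T \<subseteq> B} = card {B \<in> grid_orbit m A. T' \<subseteq> B}"
    if "T \<subseteq> grid m" "card T = t" "T' \<subseteq> grid m" "card T' = t" "cls T = cls T'" for T T'
    using assms(2)[OF that] by (simp only: cov_def)
  show "card {T. T \<subseteq> B \<and> card T = t \<and> cls T = i} = card {T. T \<subseteq> A \<and> card T = t \<and> cls T = i}"
    if "B \<in> grid_orbit m A" for B i
    using orbit_class_count[OF that assms(3)] .
qed simp

lemma index_orbit:
  assumes "\<forall>T. T \<subseteq> grid m \<and> card T = t \<longrightarrow> cov T = l"
  shows "l * (m\<^sup>2 choose t) = card (grid_orbit m A) * (\<kappa> choose t)"
  unfolding card_grid[symmetric]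
proof (rule design_index)
  show "\<forall>T. T \<subseteq> grid m \<and> card T = t \<longrightarrow> card {B \<in> grid_orbit m A. T \<subseteq> B} = l"
    using assms unfolding cov_def .
  show "B \<subseteq> grid m" "card B = \<kappa>" if "B \<in> grid_orbit m A" for B
    using grid_orbit_subset[OF A_grid that] grid_orbit_card[OF that] by auto
qed (use finite_grid_orbit[OF A_grid] in simp_all)

text \<open>Pairs form two classes, collinear and not. Their two equations add up to an identity, so
  the equation for collinear pairs decides.\<close>

lemma two_design_iff:
  "(\<exists>l>0. \<forall>T. T \<subseteq> grid m \<and> card T = 2 \<longrightarrow> cov T = l) \<longleftrightarrow>
   real (card (collinear_subsets 2 A)) = real \<kappa> * (real \<kappa> - 1) / (real m + 1)"
proof -
  let ?cls = "\<lambda>T. of_bool (collinear T) :: nat"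
  define a where "a X i = card {T. T \<subseteq> X \<and> card T = 2 \<and> ?cls T = i}" for X i
  have "(\<exists>l>0. \<forall>T. T \<subseteq> grid m \<and> card T = 2 \<longrightarrow> cov T = l) \<longleftrightarrow>
    (\<forall>i. a A i * (m\<^sup>2 choose 2) = a (grid m) i * (\<kappa> choose 2))"
    unfolding a_def
  proof (rule design_iff_class_counts_orbit)
    fix T T' assume "T \<subseteq> grid m" "card T = 2" "T' \<subseteq> grid m" "card T' = 2" "?cls T = ?cls T'"
    then show "cov T = cov T'" using cov_pair by (simp add: of_bool_eq_iff)
  next
    fix p q and T :: "(nat \<times> nat) set"
    assume pq: "p permutes {1..m}" "q permutes {1..m}" and "card T = 2"
    then show "?cls (map_prod p q ` T) = ?cls T"
      using collinear_image_bij[OF same_line_map_prod[OF pq] inj_map_prod_permutes[OF pq]]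
      by simp
  qed simp
  also have "\<dots> \<longleftrightarrow> real (card (collinear_subsets 2 A)) * (real m + 1) = real \<kappa> * (real \<kappa> - 1)"
  proof -
    have sums: "a X 0 + a X 1 = card X choose 2" if "finite X" for X
      using card_subsets_by_class[OF that, of 2 ?cls 1] by (simp add: a_def)
    have big: "a X i = 0" if "i \<noteq> 0" "i \<noteq> 1" for X i
    proof -
      have "{T. T \<subseteq> X \<and> card T = 2 \<and> ?cls T = i} = {}" using that by (auto simp: of_bool_def)
      then show ?thesis unfolding a_def by (simp only: card.empty)
    qed
    have a1: "a X 1 = card (collinear_subsets 2 X)" for X
    proof -
      have "{T. T \<subseteq> X \<and> card T = 2 \<and> ?cls T = 1} = collinear_subsets 2 X"
        by (auto simp: collinear_subsets_def of_bool_def split: if_splits)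
      then show ?thesis unfolding a_def by (simp only:)
    qed
    have "(\<forall>i. a A i * (m\<^sup>2 choose 2) = a (grid m) i * (\<kappa> choose 2)) \<longleftrightarrow>
      (\<forall>i\<in>{0, 1}. real (a A i) * real (m\<^sup>2 choose 2) = real (a (grid m) i) * real (\<kappa> choose 2))"
    proof -
      have "a A i * (m\<^sup>2 choose 2) = a (grid m) i * (\<kappa> choose 2)" if "i \<notin> {0, 1}" for i
        using that big by simp
      then show ?thesis unfolding of_nat_mult[symmetric] of_nat_eq_iff by blast
    qed
    \<comment> \<open>The class sizes add up to \<open>\<kappa> choose 2\<close> in \<open>A\<close>
      and to \<open>m^2 choose 2\<close> in the grid. The sum of the two equations is therefore
      always true, and class 0 follows from class 1.\<close>
    also have "\<dots> \<longleftrightarrow> real (a A 1) * real (m\<^sup>2 choose 2) = real (a (grid m) 1) * real (\<kappa> choose 2)"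
    proof -
      have "real (a A 0) + real (a A 1) = real (\<kappa> choose 2)"
        using sums[OF finite_subset_grid[OF A_grid]] by (simp only: of_nat_add[symmetric])
      moreover have "real (a (grid m) 0) + real (a (grid m) 1) = real (m\<^sup>2 choose 2)"
        using sums[OF finite_grid] by (simp only: of_nat_add[symmetric] card_grid)
      ultimately have "(real (a A 0) + real (a A 1)) * real (m\<^sup>2 choose 2) =
        (real (a (grid m) 0) + real (a (grid m) 1)) * real (\<kappa> choose 2)" by simp
      then show ?thesis unfolding distrib_right by auto
    qed
    also have "\<dots> \<longleftrightarrow> real (card (collinear_subsets 2 A)) * (real m + 1) = real \<kappa> * (real \<kappa> - 1)"
    proof -
      have a1_grid: "real (a (grid m) 1) = (real m)\<^sup>2 * (real m - 1)"
        unfolding a1 using card_collinear_subsets_grid[of 2 m]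
        by (simp add: real_choose_two power2_eq_square)
      have pos: "(real m)\<^sup>2 * (real m - 1) \<noteq> 0" using m3 by simp
      have cancel: "(x * (z * y / 2) = z * (w / 2)) \<longleftrightarrow> x * y = w" if "z \<noteq> 0" for x y z w :: real
        using that by (auto simp: field_simps)
      show ?thesis unfolding a1_grid real_square_choose_two real_choose_two[of \<kappa>] cancel[OF pos] unfolding a1 ..
    qed
    finally show ?thesis .
  qed
  also have "\<dots> \<longleftrightarrow> real (card (collinear_subsets 2 A)) = real \<kappa> * (real \<kappa> - 1) / (real m + 1)"
    by (simp add: field_simps)
  finally show ?thesis .
qed

lemma three_design_iff:
  "(\<exists>l>0. \<forall>T. T \<subseteq> grid m \<and> card T = 3 \<longrightarrow> cov T = l) \<longleftrightarrow>
   real (card (collinear_subsets 2 A)) = real \<kappa> * (real \<kappa> - 1) / (real m + 1) \<and>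
   real (card (collinear_subsets 3 A)) = real \<kappa> * (real \<kappa> - 1) * (real \<kappa> - 2) * (real m - 2)
     / (3 * (real m + 1) * ((real m)\<^sup>2 - 2)) \<and>
   real (card (corners A)) = real \<kappa> * (real \<kappa> - 1) * (real \<kappa> - 2) * (real m - 1)
     / ((real m + 1) * ((real m)\<^sup>2 - 2))"
  (is "_ \<longleftrightarrow> ?A2 \<and> ?A3 \<and> ?AC")
proof -
  define a where "a X i = card {T. T \<subseteq> X \<and> card T = 3 \<and> pair_count T = i}" for X i
  let ?V = "real (m\<^sup>2 choose 3)" and ?K = "real (\<kappa> choose 3)"
  \<comment> \<open>\<open>E i\<close> is the proportion required for the triples with exactly
    \<open>i\<close> collinear pairs.\<close>
  define E where "E i \<longleftrightarrow> real (a A i) * ?V = real (a (grid m) i) * ?K" for i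
  have "(\<exists>l>0. \<forall>T. T \<subseteq> grid m \<and> card T = 3 \<longrightarrow> cov T = l) \<longleftrightarrow>
    (\<forall>i. a A i * (m\<^sup>2 choose 3) = a (grid m) i * (\<kappa> choose 3))"
    unfolding a_def
  proof (rule design_iff_class_counts_orbit)
    fix T T' assume "T \<subseteq> grid m" "card T = 3" "T' \<subseteq> grid m" "card T' = 3" "pair_count T = pair_count T'"
    then show "cov T = cov T'" using cov_triple by simp
  next
    fix p q and T :: "(nat \<times> nat) set"
    assume pq: "p permutes {1..m}" "q permutes {1..m}"
    then show "pair_count (map_prod p q ` T) = pair_count T"
      using pair_count_image[OF same_line_map_prod[OF pq] inj_map_prod_permutes[OF pq]] by simp
  qed simp
  also have "\<dots> \<longleftrightarrow> (\<forall>i\<le>3. E i)"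
  proof -
    have "a X i = 0" if "\<not> i \<le> 3" for X i
    proof -
      have "{T. T \<subseteq> X \<and> card T = 3 \<and> pair_count T = i} = {}" using that pair_count_le_3 by auto
      then show ?thesis unfolding a_def by (simp only: card.empty)
    qed
    then have "E i" if "\<not> i \<le> 3" for i using that by (simp add: E_def)
    then have "(\<forall>i\<le>3. E i) \<longleftrightarrow> (\<forall>i. E i)" by blast
    then show ?thesis unfolding E_def of_nat_mult[symmetric] of_nat_eq_iff by simp
  qed
  also have "\<dots> \<longleftrightarrow> E 0 \<and> E 1 \<and> E 2 \<and> E 3"
    by (auto simp: le_Suc_eq numeral_3_eq_3 numeral_2_eq_2)
  \<comment> \<open>The sum of the four equations always holds, and their sum with weights
    \<open>i\<close> is \<open>?A2\<close> up to a nonzero factor. Given \<open>E 2\<close> and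
    \<open>E 3\<close>, the condition \<open>?A2\<close> thus amounts to \<open>E 1\<close>, and
    \<open>E 0\<close> follows from the plain sum.\<close>
  also have "\<dots> \<longleftrightarrow> ?A2 \<and> E 3 \<and> E 2"
  proof -
    let ?P = "\<lambda>X. real (card (collinear_subsets 2 X))"
    have total: "real (a X 0) + real (a X 1) + real (a X 2) + real (a X 3) = real (card X choose 3)"
      if "finite X" for X
      using card_subsets_by_class[OF that, of 3 pair_count 3] pair_count_le_3
      by (simp add: a_def numeral_3_eq_3 numeral_2_eq_2 flip: of_nat_add)
    \<comment> \<open>\<open>2 \<le> card X\<close> keeps \<open>card X - 2\<close> from truncating,
      so \<open>pair_count_sum\<close> carries over to the reals.\<close>
    have paths: "real (a X 1) + 2 * real (a X 2) + 3 * real (a X 3) = ?P X * (real (card X) - 2)"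
      if "finite X" "2 \<le> card X" for X
    proof -
      have "real (card (collinear_subsets 2 X) * (card X - 2)) =
        real (\<Sum>i\<le>3. i * card {T. T \<subseteq> X \<and> card T = 3 \<and> pair_count T = i})"
        using pair_count_sum[OF that(1)] by simp
      then show ?thesis
        using that(2) by (simp add: a_def numeral_3_eq_3 numeral_2_eq_2 of_nat_diff)
    qed
    have A: "real (a A 0) + real (a A 1) + real (a A 2) + real (a A 3) = ?K"
      "real (a A 1) + 2 * real (a A 2) + 3 * real (a A 3) = ?P A * (real \<kappa> - 2)"
      using total[of A] paths[of A] finite_subset_grid[OF A_grid] A_card by auto
    have G: "real (a (grid m) 0) + real (a (grid m) 1) + real (a (grid m) 2) + real (a (grid m) 3) = ?V"
      "real (a (grid m) 1) + 2 * real (a (grid m) 2) + 3 * real (a (grid m) 3) = ?P (grid m) * ((real m)\<^sup>2 - 2)"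
      using total[of "grid m"] paths[of "grid m"] v_gt by (simp_all add: card_grid)
    have grid_pairs: "?P (grid m) = (real m)\<^sup>2 * (real m - 1)"
      using card_collinear_subsets_grid[of 2 m] by (simp add: real_choose_two power2_eq_square)
    have V: "?V = (real m)\<^sup>2 * (real m - 1) * (real m + 1) * ((real m)\<^sup>2 - 2) / 6"
      by (simp only: real_square_choose_three mult.assoc)
    have K: "?K = real \<kappa> * (real \<kappa> - 1) * (real \<kappa> - 2) / 6" by (simp add: real_choose_three)
    have pos: "(real m)\<^sup>2 * (real m - 1) * ((real m)\<^sup>2 - 2) * (real \<kappa> - 2) \<noteq> 0"
    proof -
      show ?thesis using real_v_gt m3 A_card by auto
    qed
    have "?A2 \<longleftrightarrow> ?P A * (real m + 1) = real \<kappa> * (real \<kappa> - 1)" by (simp add: field_simps)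
    \<comment> \<open>Multiplication by the nonzero factor in \<open>pos\<close> brings the pair
      condition into the form of the weighted sum; \<open>\<kappa> - 2\<close> is nonzero because
      \<open>\<kappa>\<close> is at least 3.\<close>
    also have "\<dots> \<longleftrightarrow> ?P A * (real m + 1) * ((real m)\<^sup>2 * (real m - 1) * ((real m)\<^sup>2 - 2) * (real \<kappa> - 2))
      = real \<kappa> * (real \<kappa> - 1) * ((real m)\<^sup>2 * (real m - 1) * ((real m)\<^sup>2 - 2) * (real \<kappa> - 2))"
      using pos by (simp only: mult_cancel_right) simp
    also have "\<dots> \<longleftrightarrow> (?P A * (real \<kappa> - 2)) * ?V = (?P (grid m) * ((real m)\<^sup>2 - 2)) * ?K"
    proof -
      have "(P * x * (M * W * q) = z * (M * W * q)) \<longleftrightarrow> (P * q) * (M * x * W / 6) = (M * W) * (z * q / 6)"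
        for P x M W q z :: real
      proof -
        have "(P * q) * (M * x * W / 6) = (P * x * (M * W * q)) / 6" "(M * W) * (z * q / 6) = (z * (M * W * q)) / 6"
          by simp_all
        then show ?thesis by (simp only: divide_cancel_right) simp
      qed
      then show ?thesis unfolding V K grid_pairs .
    qed
    also have "\<dots> \<longleftrightarrow> (real (a A 1) + 2 * real (a A 2) + 3 * real (a A 3)) * ?V
       = (real (a (grid m) 1) + 2 * real (a (grid m) 2) + 3 * real (a (grid m) 3)) * ?K"
      using A(2) G(2) by simp
    finally have A2: "?A2 \<longleftrightarrow> \<dots>" .
    have "(real (a A 0) + real (a A 1) + real (a A 2) + real (a A 3)) * ?V
       = (real (a (grid m) 0) + real (a (grid m) 1) + real (a (grid m) 2) + real (a (grid m) 3)) * ?K"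
      using A(1) G(1) by simp
    then show ?thesis unfolding A2 E_def distrib_right mult.assoc by linarith
  qed
  also have "\<dots> \<longleftrightarrow> ?A2 \<and> ?A3 \<and> ?AC"
  proof -
    have pos: "(real m)\<^sup>2 * (real m - 1) \<noteq> 0" "(real m + 1) * ((real m)\<^sup>2 - 2) \<noteq> 0"
    proof -
      show "(real m)\<^sup>2 * (real m - 1) \<noteq> 0" "(real m + 1) * ((real m)\<^sup>2 - 2) \<noteq> 0" using real_v_gt m3 by auto
    qed
    have K: "?K = real \<kappa> * (real \<kappa> - 1) * (real \<kappa> - 2) / 6" by (simp add: real_choose_three)
    have a2: "real (a (grid m) 2) = (real m)\<^sup>2 * (real m - 1) * (real m - 1)"
      using card_corners_grid[of m] m3 by (simp add: a_def corners_eq power2_eq_square of_nat_diff)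
    have a3: "real (a (grid m) 3) = (real m)\<^sup>2 * (real m - 1) * ((real m - 2) / 3)"
      using card_collinear_subsets_grid[of 3 m]
      by (simp add: a_def collinear_subsets_3 real_choose_three power2_eq_square)
    \<comment> \<open>\<open>z\<close> is the common factor \<open>m^2 (m - 1)\<close>, and
      \<open>y\<close> is the remaining part \<open>(m + 1) (m^2 - 2)\<close> of
      \<open>m^2 choose 3\<close>.\<close>
    have cancel: "(x * (z * y / 6) = z * u * (w / 6)) \<longleftrightarrow> x = w * u / y" if "z \<noteq> 0" "y \<noteq> 0" for x y z u w :: real
      using that by (auto simp: field_simps)
    have "E 3 \<longleftrightarrow> ?A3"
      unfolding E_def a3 real_square_choose_three K cancel[OF pos]
      by (simp only: a_def collinear_subsets_3 times_divide_eq_right divide_divide_eq_left mult.assoc)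
    moreover have "E 2 \<longleftrightarrow> ?AC"
      unfolding E_def a2 real_square_choose_three K cancel[OF pos] by (simp add: a_def corners_eq)
    ultimately show ?thesis by blast
  qed
  finally show ?thesis .
qed

end

section \<open>Subgraphs as grid subsets\<close>

definition edge :: "nat \<times> nat \<Rightarrow> vertex set" where
  "edge e = {Row (fst e), Col (snd e)}"

definition vertex_map :: "(nat \<Rightarrow> nat) \<Rightarrow> (nat \<Rightarrow> nat) \<Rightarrow> vertex \<Rightarrow> vertex" where
  "vertex_map p q v = (case v of Row i \<Rightarrow> Row (p i) | Col j \<Rightarrow> Col (q j))"

lemma inj_edge: "inj edge"
  by (rule injI) (auto simp: edge_def doubleton_eq_iff prod_eq_iff)

lemma edge_eq_iff [simp]: "edge e = edge f \<longleftrightarrow> e = f"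
  using inj_edge by (rule inj_eq)

lemma Kmm_eq: "Kmm m = edge ` grid m"
  by (force simp: Kmm_def complete_bipartite_def rows_def cols_def edge_def grid_def image_iff)

lemma graph_act_vertex_map:
  "graph_act (vertex_map p q) (edge ` A) = edge ` map_prod p q ` A"
proof -
  have "vertex_map p q ` edge e = edge (map_prod p q e)" for e
    by (simp add: edge_def vertex_map_def)
  then show ?thesis by (simp add: graph_act_def image_image)
qed

text \<open>\<open>tau\<close> exchanges the two kinds of vertices only for indices in
  \<open>{1..m}\<close>, hence the restriction to subsets of the grid.\<close>

lemma graph_act_tau:
  assumes "A \<subseteq> grid m"
  shows "graph_act (tau m) (edge ` A) = edge ` prod.swap ` A"
proof -
  have "tau m ` edge e = edge (prod.swap e)" if "e \<in> A" for e
  proof -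
    have "fst e \<in> {1..m}" "snd e \<in> {1..m}" using assms that by (auto simp: grid_def)
    then show ?thesis by (simp add: edge_def tau_def insert_commute)
  qed
  then show ?thesis by (simp add: graph_act_def image_image)
qed

lemma graph_act_comp: "graph_act (g \<circ> h) \<Delta> = graph_act g (graph_act h \<Delta>)"
  by (simp add: graph_act_def image_image image_comp)

lemma graph_act_id: "graph_act id \<Delta> = \<Delta>"
  by (simp add: graph_act_def)

lemma vertex_degree_Row: "vertex_degree (edge ` A) (Row i) = row_degree A i"
proof -
  have "{e \<in> edge ` A. Row i \<in> e} = edge ` {e \<in> A. fst e = i}" by (auto simp: edge_def)
  then show ?thesis
    by (simp add: vertex_degree_def row_degree_def card_image inj_on_subset[OF inj_edge])
qed

lemma vertex_degree_Col: "vertex_degree (edge ` A) (Col j) = col_degree A j"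
proof -
  have "{e \<in> edge ` A. Col j \<in> e} = edge ` {e \<in> A. snd e = j}" by (auto simp: edge_def)
  then show ?thesis
    by (simp add: vertex_degree_def col_degree_def card_image inj_on_subset[OF inj_edge])
qed

section \<open>Paths and claws as configurations of cells\<close>

lemma edge_doubleton:
  "{u, v} = edge e \<longleftrightarrow>
    u = Row (fst e) \<and> v = Col (snd e) \<or> u = Col (snd e) \<and> v = Row (fst e)"
  by (auto simp: edge_def doubleton_eq_iff)

text \<open>Splits off the edge at index 0; together with \<open>path_edges_single\<close> it
  unfolds the edge set of a concrete vertex list.\<close>

lemma path_edges_Cons: "path_edges (x # y # zs) = insert {x, y} (path_edges (y # zs))"
proof -
  have "{i. Suc i < length (x # y # zs)} = insert 0 (Suc ` {i. Suc i < length (y # zs)})"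
    by (auto simp: image_iff) (metis Suc_less_eq not0_implies_Suc)
  then have "(\<lambda>i. {(x # y # zs) ! i, (x # y # zs) ! Suc i}) ` {i. Suc i < length (x # y # zs)}
    = insert {x, y} ((\<lambda>i. {(y # zs) ! i, (y # zs) ! Suc i}) ` {i. Suc i < length (y # zs)})"
    by (simp add: image_image)
  then show ?thesis unfolding path_edges_def by (simp only: setcompr_eq_image)
qed

lemma path_edges_single: "path_edges [x] = {}"
  by (simp add: path_edges_def)

text \<open>The middle vertex of a 2-path is the row or column common to its two cells, and the end
  vertices are their other coordinates.\<close>

lemma paths_2_eq: "paths 2 (edge ` A) = (`) edge ` collinear_subsets 2 A"
proof (intro equalityI subsetI)
  fix F assume "F \<in> paths 2 (edge ` A)"
  then obtain vs where F: "F \<subseteq> edge ` A" and vs: "length vs = 3" "distinct vs" "F = path_edges vs"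
    by (auto simp: paths_def)
  then obtain u v w where uvw: "vs = [u, v, w]" by (auto simp: length_Suc_conv numeral_3_eq_3)
  then have F2: "F = {{u, v}, {v, w}}" using vs(3) by (simp add: path_edges_Cons path_edges_single)
  then obtain e f where ef: "e \<in> A" "f \<in> A" "{u, v} = edge e" "{v, w} = edge f" using F by auto
  then have "same_line e f" by (auto simp: edge_doubleton same_line_def)
  moreover have "e \<noteq> f" using ef(3,4) vs(2) uvw by (auto simp: edge_doubleton)
  ultimately have "{e, f} \<in> collinear_subsets 2 A"
    using ef by (simp add: collinear_subsets_def collinear_pair)
  moreover have "F = edge ` {e, f}" using F2 ef by simp
  ultimately show "F \<in> (`) edge ` collinear_subsets 2 A" by blast
next
  fix F assume "F \<in> (`) edge ` collinear_subsets 2 A"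
  then obtain T where T: "T \<subseteq> A" "card T = 2" "collinear T" "F = edge ` T"
    by (auto simp: collinear_subsets_def)
  obtain e f where ef: "T = {e, f}" "e \<noteq> f" using T(2) unfolding card_2_iff by blast
  have "\<exists>vs. length vs = 3 \<and> distinct vs \<and> F = path_edges vs"
  proof (cases "fst e = fst f")
    case True
    with ef(2) have "snd e \<noteq> snd f" by (simp add: prod_eq_iff)
    with True show ?thesis unfolding T(4) ef(1)
      by (intro exI[of _ "[Col (snd e), Row (fst e), Col (snd f)]"])
        (simp add: path_edges_Cons path_edges_single edge_def insert_commute)
  next
    case False
    then have "snd e = snd f" using T(3) ef(1) by (simp add: collinear_pair same_line_def)
    with False show ?thesis unfolding T(4) ef(1)
      by (intro exI[of _ "[Row (fst e), Col (snd e), Row (fst f)]"])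
        (simp add: path_edges_Cons path_edges_single edge_def insert_commute)
  qed
  then show "F \<in> paths 2 (edge ` A)" using T by (auto simp: paths_def)
qed

lemma cornersI:
  "a \<noteq> d \<Longrightarrow> b \<noteq> c \<Longrightarrow> {(a, b), (a, c), (d, c)} \<subseteq> A \<Longrightarrow> {(a, b), (a, c), (d, c)} \<in> corners A"
  unfolding corners_def by blast

text \<open>The middle edge of a 3-path is the centre of a corner: one of its ends is a row, the
  other a column, and each carries one of the two outer edges.\<close>

lemma paths_3_eq: "paths 3 (edge ` A) = (`) edge ` corners A"
proof (intro equalityI subsetI)
  fix F assume "F \<in> paths 3 (edge ` A)"
  then obtain vs where F: "F \<subseteq> edge ` A" and vs: "length vs = 4" "distinct vs" "F = path_edges vs"
    by (auto simp: paths_def)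
  then obtain u v w x where uvw: "vs = [u, v, w, x]"
    by (auto simp: length_Suc_conv numeral_3_eq_3 eval_nat_numeral)
  then have F3: "F = {{u, v}, {v, w}, {w, x}}"
    using vs(3) by (simp add: path_edges_Cons path_edges_single)
  then obtain e f g where e: "e \<in> A" "f \<in> A" "g \<in> A"
    "{u, v} = edge e" "{v, w} = edge f" "{w, x} = edge g" using F by auto
  then have F_eq: "F = edge ` {e, f, g}" using F3 by simp
  have "u \<noteq> w" "v \<noteq> x" using vs(2) uvw by auto
  \<comment> \<open>The two alternatives are the paths starting at a column and at a row;
    \<open>u \<noteq> w\<close> and \<open>v \<noteq> x\<close> supply the inequalities.\<close>
  then have "fst e = fst f \<and> snd f = snd g \<and> snd e \<noteq> snd f \<and> fst f \<noteq> fst g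
    \<or> snd e = snd f \<and> fst f = fst g \<and> fst e \<noteq> fst f \<and> snd f \<noteq> snd g"
    using e(4-6) by (auto simp: edge_doubleton)
  then consider "fst e = fst f" "snd f = snd g" "snd e \<noteq> snd f" "fst f \<noteq> fst g"
    | "snd e = snd f" "fst f = fst g" "fst e \<noteq> fst f" "snd f \<noteq> snd g"
    by blast
  then have "{e, f, g} \<in> corners A"
  proof cases
    case 1
    then have eq: "{e, f, g} = {(fst f, snd e), (fst f, snd f), (fst g, snd f)}"
      by (metis prod.collapse)
    have "{(fst f, snd e), (fst f, snd f), (fst g, snd f)} \<subseteq> A"
      unfolding eq[symmetric] using e by simp
    with 1 show ?thesis unfolding eq by (intro cornersI)
  next
    case 2
    then have eq: "{e, f, g} = {(fst f, snd g), (fst f, snd f), (fst e, snd f)}"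
      by (metis insert_commute prod.collapse)
    have "{(fst f, snd g), (fst f, snd f), (fst e, snd f)} \<subseteq> A"
      unfolding eq[symmetric] using e by simp
    with 2 show ?thesis unfolding eq by (intro cornersI) simp_all
  qed
  then show "F \<in> (`) edge ` corners A" using F_eq by blast
next
  fix F assume "F \<in> (`) edge ` corners A"
  then obtain T a b c d where T: "T \<subseteq> A" "F = edge ` T" "a \<noteq> d" "b \<noteq> c"
    "T = {(a, b), (a, c), (d, c)}" unfolding corners_def by blast
  have "F = path_edges [Col b, Row a, Col c, Row d]"
    by (simp add: T path_edges_Cons path_edges_single edge_def insert_commute)
  moreover have "distinct [Col b, Row a, Col c, Row d]" "length [Col b, Row a, Col c, Row d] = 3 + 1"
    using T by auto
  moreover have "F \<subseteq> edge ` A" using T by blast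
  ultimately show "F \<in> paths 3 (edge ` A)" unfolding paths_def by blast
qed

lemma complete_bipartite_singleton: "complete_bipartite {a} B = (\<lambda>b. {a, b}) ` B"
  by (auto simp: complete_bipartite_def)

text \<open>The centre of a claw is the common line of three cells, and its leaves are their other
  coordinates.\<close>

lemma claws3_eq: "claws3 (edge ` A) = (`) edge ` collinear_subsets 3 A"
proof (intro equalityI subsetI)
  fix F assume "F \<in> claws3 (edge ` A)"
  then obtain X B where F: "F \<subseteq> edge ` A" "card X = 1" "card B = 3" "F = complete_bipartite X B"
    by (auto simp: claws3_def)
  then obtain a where a: "X = {a}" by (metis card_1_singletonE)
  have F_eq: "F = (\<lambda>b. {a, b}) ` B" unfolding F(4) a complete_bipartite_singleton ..
  obtain T where T: "T \<subseteq> A" "F = edge ` T" using F(1) by (auto simp: subset_image_iff)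
  have "inj_on (\<lambda>b. {a, b}) B" by (auto simp: inj_on_def doubleton_eq_iff)
  then have "card F = 3" by (simp add: F_eq card_image F(3))
  then have "card T = 3" by (simp add: T(2) card_image inj_on_subset[OF inj_edge])
  moreover have "collinear T"
  proof -
    have mem: "a \<in> edge e" if "e \<in> T" for e using that F_eq T(2) by auto
    show ?thesis
    proof (cases a)
      case (Row i)
      then have "fst ` T \<subseteq> {i}" using mem by (auto simp: edge_def)
      then show ?thesis unfolding collinear_def by blast
    next
      case (Col j)
      then have "snd ` T \<subseteq> {j}" using mem by (auto simp: edge_def)
      then show ?thesis unfolding collinear_def by blast
    qed
  qed
  ultimately show "F \<in> (`) edge ` collinear_subsets 3 A" using T by (auto simp: collinear_subsets_def)
next
  fix F assume "F \<in> (`) edge ` collinear_subsets 3 A"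
  then obtain T where T: "T \<subseteq> A" "card T = 3" "collinear T" "F = edge ` T"
    by (auto simp: collinear_subsets_def)
  have "\<exists>a B. a \<notin> B \<and> card B = 3 \<and> F = complete_bipartite {a} B"
    using T(3) unfolding collinear_def
  proof (elim disjE exE)
    fix i assume i: "fst ` T \<subseteq> {i}"
    \<comment> \<open>Cells of one row are told apart by their columns, so the claw has three
      distinct leaves.\<close>
    then have "inj_on (\<lambda>e. Col (snd e)) T" by (auto simp: inj_on_def image_subset_iff prod_eq_iff)
    then have "card ((\<lambda>e. Col (snd e)) ` T) = 3" by (simp add: card_image T(2))
    moreover have "F = complete_bipartite {Row i} ((\<lambda>e. Col (snd e)) ` T)"
      unfolding complete_bipartite_singleton T(4) image_image
      by (rule image_cong) (use i in \<open>auto simp: edge_def\<close>)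
    ultimately show ?thesis by (intro exI[of _ "Row i"] exI[of _ "(\<lambda>e. Col (snd e)) ` T"]) auto
  next
    fix j assume j: "snd ` T \<subseteq> {j}"
    then have "inj_on (\<lambda>e. Row (fst e)) T" by (auto simp: inj_on_def image_subset_iff prod_eq_iff)
    then have "card ((\<lambda>e. Row (fst e)) ` T) = 3" by (simp add: card_image T(2))
    moreover have "F = complete_bipartite {Col j} ((\<lambda>e. Row (fst e)) ` T)"
      unfolding complete_bipartite_singleton T(4) image_image
      by (rule image_cong) (use j in \<open>auto simp: edge_def\<close>)
    ultimately show ?thesis by (intro exI[of _ "Col j"] exI[of _ "(\<lambda>e. Row (fst e)) ` T"]) auto
  qed
  then obtain a B where "a \<notin> B" "card B = 3" "F = complete_bipartite {a} B" by blast
  then have "card {a} = 1 \<and> card B = 3 \<and> {a} \<inter> B = {} \<and> F = complete_bipartite {a} B" by simp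
  moreover have "F \<subseteq> edge ` A" using T by blast
  ultimately show "F \<in> claws3 (edge ` A)" unfolding claws3_def by blast
qed

lemma card_image_edge: "card ((`) edge ` X) = card X"
  by (simp add: card_image inj_image_sets[OF inj_edge])

section \<open>The group \<open>K\<close> and its action on graphs\<close>

lemma vertex_map_comp: "vertex_map p q \<circ> vertex_map p' q' = vertex_map (p \<circ> p') (q \<circ> q')"
  by (auto simp: vertex_map_def fun_eq_iff split: vertex.split)

lemma vertex_map_id: "vertex_map id id = id"
  by (auto simp: vertex_map_def fun_eq_iff split: vertex.split)

lemma vertex_map_inject: "vertex_map p q = vertex_map p' q' \<longleftrightarrow> p = p' \<and> q = q'"
proof
  assume eq: "vertex_map p q = vertex_map p' q'"
  have "p i = p' i" for i using fun_cong[OF eq, of "Row i"] by (simp add: vertex_map_def)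
  moreover have "q i = q' i" for i using fun_cong[OF eq, of "Col i"] by (simp add: vertex_map_def)
  ultimately show "p = p' \<and> q = q'" by auto
qed simp

lemma vertex_map_permutes:
  assumes "p permutes S" "q permutes S'"
  shows "vertex_map p q permutes Row ` S \<union> Col ` S'"
proof -
  have "vertex_map p q \<circ> vertex_map (inv_into UNIV p) (inv_into UNIV q) = id"
    "vertex_map (inv_into UNIV p) (inv_into UNIV q) \<circ> vertex_map p q = id"
    by (simp_all only: vertex_map_comp permutes_inv_o[OF assms(1)] permutes_inv_o[OF assms(2)] vertex_map_id)
  then have "bij (vertex_map p q)" using o_bij by blast
  moreover have "vertex_map p q v = v" if "v \<notin> Row ` S \<union> Col ` S'" for v
    using that permutes_not_in[OF assms(1)] permutes_not_in[OF assms(2)]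
    by (cases v) (auto simp: vertex_map_def image_iff)
  ultimately show ?thesis by (simp add: permutes_def bij_iff)
qed

lemma permutes_image_conjugate:
  assumes "P permutes f ` S" "inj f"
  obtains p where "p permutes S" "\<And>i. P (f i) = f (p i)"
proof
  let ?p = "\<lambda>i. inv_into UNIV f (P (f i))"
  show eq: "P (f i) = f (?p i)" for i
  proof (cases "i \<in> S")
    case True
    then have "P (f i) \<in> f ` S" using permutes_in_image[OF assms(1)] by simp
    then show ?thesis by (auto simp: assms(2) inv_f_f)
  next
    case False
    then have "P (f i) = f i" using assms permutes_not_in by (fastforce simp: inj_image_mem_iff)
    then show ?thesis by (simp add: assms(2) inv_f_f)
  qed
  show "?p permutes S"
  proof -
    have "?p i = i" if "i \<notin> S" for i
    proof -
      have "f i \<notin> f ` S" using that assms(2) by (simp add: inj_image_mem_iff)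
      then have "P (f i) = f i" using assms(1) by (simp add: permutes_not_in)
      then show ?thesis by (simp add: assms(2) inv_f_f)
    qed
    moreover have "bij_betw ?p S S"
    proof -
      have "bij_betw f S (f ` S)" using inj_on_subset[OF assms(2)] by (simp add: bij_betw_def)
      moreover have "bij_betw P (f ` S) (f ` S)" by (rule permutes_imp_bij[OF assms(1)])
      moreover have "bij_betw (inv_into UNIV f) (f ` S) S"
        using assms(2) by (auto simp: bij_betw_def inj_on_def image_iff)
      ultimately have "bij_betw (inv_into UNIV f \<circ> (P \<circ> f)) S S" by (blast intro: bij_betw_trans)
      then show ?thesis by (simp add: comp_def)
    qed
    ultimately show ?thesis by (intro bij_imp_permutes)
  qed
qed

text \<open>The two factors have disjoint supports: \<open>P\<close> fixes every column vertex and
  \<open>Q\<close> every row vertex, so their product acts on rows and columns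
  independently.\<close>

lemma K_group_carrier:
  "carrier (K_group m) = {vertex_map p q | p q. p permutes {1..m} \<and> q permutes {1..m}}"
proof (intro equalityI subsetI)
  fix g assume "g \<in> carrier (K_group m)"
  then obtain P Q where g: "g = P \<circ> Q" and P: "P permutes Row ` {1..m}" and Q: "Q permutes Col ` {1..m}"
    by (auto simp: K_group_def sym_on_def rows_def cols_def)
  obtain p where p: "p permutes {1..m}" "\<And>i. P (Row i) = Row (p i)"
    using permutes_image_conjugate[OF P] by (auto simp: inj_def)
  obtain q where q: "q permutes {1..m}" "\<And>i. Q (Col i) = Col (q i)"
    using permutes_image_conjugate[OF Q] by (auto simp: inj_def)
  have "Q (Row i) = Row i" "P (Col i) = Col i" for i
    using permutes_not_in[OF Q, of "Row i"] permutes_not_in[OF P, of "Col i"] by auto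
  then have "g = vertex_map p q"
    by (auto simp: g fun_eq_iff vertex_map_def p(2) q(2) split: vertex.split)
  with p q show "g \<in> {vertex_map p q | p q. p permutes {1..m} \<and> q permutes {1..m}}" by blast
next
  fix g assume "g \<in> {vertex_map p q | p q. p permutes {1..m} \<and> q permutes {1..m}}"
  then obtain p q where g: "g = vertex_map p q" and pq: "p permutes {1..m}" "q permutes {1..m}"
    by blast
  \<comment> \<open>\<open>id\<close> permutes the empty set, so each of the two factors moves
    vertices of one part only.\<close>
  have "vertex_map p id permutes Row ` {1..m}" "vertex_map id q permutes Col ` {1..m}"
    using vertex_map_permutes[OF pq(1), of id "{}"] vertex_map_permutes[OF _ pq(2), of id "{}"] by simp_all
  moreover have "g = vertex_map p id \<circ> vertex_map id q" by (simp add: g vertex_map_comp)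
  ultimately show "g \<in> carrier (K_group m)"
    by (auto simp: K_group_def sym_on_def rows_def cols_def)
qed

lemma sym_on_inv:
  assumes "g permutes S"
  shows "inv\<^bsub>sym_on S\<^esub> g = inv_into UNIV g"
proof (rule group.inv_equality[OF sym_on_is_group])
  show "inv_into UNIV g \<otimes>\<^bsub>sym_on S\<^esub> g = \<one>\<^bsub>sym_on S\<^esub>"
    using permutes_inv_o(2)[OF assms] by (simp add: sym_on_def)
qed (use assms permutes_inv in \<open>auto simp: sym_on_def\<close>)

lemma inv_vertex_map:
  assumes "p permutes S" "q permutes S'"
  shows "inv_into UNIV (vertex_map p q) = vertex_map (inv_into UNIV p) (inv_into UNIV q)"
  by (rule inv_unique_comp)
    (simp_all only: vertex_map_comp permutes_inv_o[OF assms(1)] permutes_inv_o[OF assms(2)] vertex_map_id)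

lemma tau_comp_tau: "tau m \<circ> tau m = id"
  by (auto simp: fun_eq_iff tau_def split: vertex.split)

text \<open>\<open>K_group\<close> is given by replacing a carrier, so closure under products and
  inverses has to be established; both are read off from \<open>K_group_carrier\<close>.\<close>

lemma K_group_is_group: "Group.group (K_group m)"
proof -
  let ?V = "rows m \<union> cols m"
  have "subgroup (carrier (K_group m)) (sym_on ?V)"
  proof (rule group.subgroupI[OF sym_on_is_group K_group_subset])
    have "vertex_map id id \<in> carrier (K_group m)" unfolding K_group_carrier by (blast intro: permutes_id)
    then show "carrier (K_group m) \<noteq> {}" by blast
  next
    fix g assume g: "g \<in> carrier (K_group m)"
    then have "inv\<^bsub>sym_on ?V\<^esub> g = inv_into UNIV g"
      using K_group_subset[of m] by (intro sym_on_inv) (auto simp: sym_on_def)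
    moreover obtain p q where pq: "p permutes {1..m}" "q permutes {1..m}" "g = vertex_map p q"
      using g unfolding K_group_carrier by blast
    ultimately have "inv\<^bsub>sym_on ?V\<^esub> g = vertex_map (inv_into UNIV p) (inv_into UNIV q)"
      using inv_vertex_map[OF pq(1,2)] by simp
    then show "inv\<^bsub>sym_on ?V\<^esub> g \<in> carrier (K_group m)"
      unfolding K_group_carrier using permutes_inv[OF pq(1)] permutes_inv[OF pq(2)] by blast
  next
    fix g h assume "g \<in> carrier (K_group m)" "h \<in> carrier (K_group m)"
    then show "g \<otimes>\<^bsub>sym_on ?V\<^esub> h \<in> carrier (K_group m)"
      unfolding K_group_carrier by (auto simp: sym_on_def vertex_map_comp) (metis permutes_compose)
  qed
  then have "Group.group (sym_on ?V \<lparr>carrier := carrier (K_group m)\<rparr>)"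
    by (rule subgroup.subgroup_is_group[OF _ sym_on_is_group])
  then show ?thesis by (simp add: K_group_def)
qed

lemma K_group_mult: "g \<otimes>\<^bsub>K_group m\<^esub> h = g \<circ> h"
  by (simp add: K_group_def sym_on_def)

lemma order_K_group: "order (K_group m) = (fact m)\<^sup>2"
proof -
  let ?S = "{p. p permutes {1..m}}"
  have "carrier (K_group m) = (\<lambda>(p, q). vertex_map p q) ` (?S \<times> ?S)"
    unfolding K_group_carrier by auto
  moreover have "inj_on (\<lambda>(p, q). vertex_map p q) (?S \<times> ?S)"
    by (auto simp: inj_on_def vertex_map_inject)
  moreover have "card ?S = fact m" by (rule card_permutations) auto
  ultimately show ?thesis
    by (simp add: order_def card_image card_cartesian_product power2_eq_square)
qed

text \<open>Each \<open>graph_act g\<close> is a bijection on all graphs, with the action of the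
  inverse permutation as its inverse. This makes the orbit-stabiliser theorem available.\<close>

lemma graph_action: "group_action (K_group m) UNIV graph_act"
proof -
  have bij: "graph_act g \<in> Bij UNIV" if "g \<in> carrier (K_group m)" for g
  proof -
    have "g permutes rows m \<union> cols m" using that K_group_subset[of m] by (auto simp: sym_on_def)
    then have inv: "g \<circ> inv_into UNIV g = id" "inv_into UNIV g \<circ> g = id"
      using permutes_inv_o by auto
    have "graph_act g \<circ> graph_act (inv_into UNIV g) = id"
      "graph_act (inv_into UNIV g) \<circ> graph_act g = id"
      by (simp_all add: fun_eq_iff graph_act_comp[symmetric] inv graph_act_id)
    then have "bij (graph_act g)" using o_bij by blast
    then show ?thesis by (simp add: Bij_def)
  qed
  then have "graph_act \<in> hom (K_group m) (BijGroup UNIV)"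
    by (intro homI) (auto simp: BijGroup_def K_group_mult compose_def graph_act_comp fun_eq_iff)
  then show ?thesis
    using K_group_is_group group_BijGroup
    by (simp add: group_action_def group_hom_def group_hom_axioms_def)
qed

lemma orbit_edge_image: "orbit (K_group m) graph_act (edge ` A) = (`) edge ` grid_orbit m A"
proof -
  have "orbit (K_group m) graph_act (edge ` A) =
      {graph_act (vertex_map p q) (edge ` A) | p q. p permutes {1..m} \<and> q permutes {1..m}}"
    unfolding orbit_def K_group_carrier by blast
  also have "\<dots> = (`) edge ` grid_orbit m A"
    unfolding graph_act_vertex_map grid_orbit_def by blast
  finally show ?thesis .
qed

text \<open>Orbit-stabiliser theorem for \<open>K\<close>. It expresses the number of blocks through
  the order of the stabiliser that appears in the formulas for \<lambda>.\<close>

lemma card_orbit_stabilizer: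
  "card (grid_orbit m A) * card (K_stabilizer m (edge ` A)) = (fact m)\<^sup>2"
proof -
  interpret group_action "K_group m" UNIV graph_act by (rule graph_action)
  have "card (orbit (K_group m) graph_act (edge ` A)) * card (stabilizer (K_group m) graph_act (edge ` A))
    = order (K_group m)" by (rule orbit_stabilizer_theorem) simp
  then show ?thesis by (simp add: orbit_edge_image card_image_edge order_K_group K_stabilizer_def)
qed

section \<open>Points and blocks in terms of cells\<close>

definition point :: "nat \<times> nat \<Rightarrow> vertex \<times> vertex" where
  "point = map_prod Row Col"

lemma inj_point: "inj point"
  unfolding point_def by (intro prod.inj_map) (auto simp: inj_def)

lemma points_eq: "points m = point ` grid m"
  by (auto simp: points_def point_def grid_def rows_def cols_def)

lemma block_edge_image:
  assumes "A \<subseteq> grid m"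
  shows "block m (edge ` A) = point ` A"
proof (intro equalityI subsetI)
  fix x assume "x \<in> block m (edge ` A)"
  then obtain i j where x: "x = (Row i, Col j)" and "{Row i, Col j} \<in> edge ` A"
    by (auto simp: block_def points_def rows_def cols_def)
  then have "edge (i, j) \<in> edge ` A" by (simp add: edge_def)
  then have "(i, j) \<in> A" using inj_image_mem_iff[OF inj_edge] by simp
  then show "x \<in> point ` A" using x by (auto simp: point_def intro!: image_eqI[of _ _ "(i, j)"])
next
  fix x assume "x \<in> point ` A"
  then obtain i j where x: "x = (Row i, Col j)" and ij: "(i, j) \<in> A" by (auto simp: point_def)
  then have "edge (i, j) \<in> edge ` A" "(i, j) \<in> grid m" using assms by auto
  then show "x \<in> block m (edge ` A)"
    using x by (auto simp: block_def points_def rows_def cols_def edge_def grid_def)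
qed

text \<open>Stated for an arbitrary \<open>H\<close> so that it serves both \<open>K\<close> and
  \<open>G\<close>.\<close>

lemma blocks_of_orbit:
  assumes "A \<subseteq> grid m"
    and "{graph_act g (edge ` A) | g. g \<in> carrier H} = (`) edge ` grid_orbit m A"
  shows "{block m (graph_act g (edge ` A)) | g. g \<in> carrier H} = (`) point ` grid_orbit m A"
proof -
  have "{block m (graph_act g (edge ` A)) | g. g \<in> carrier H} =
      block m ` {graph_act g (edge ` A) | g. g \<in> carrier H}" by blast
  also have "\<dots> = (\<lambda>B. block m (edge ` B)) ` grid_orbit m A"
    unfolding assms(2) image_image ..
  also have "\<dots> = (`) point ` grid_orbit m A"
    using block_edge_image grid_orbit_subset[OF assms(1)] by (intro image_cong) auto
  finally show ?thesis .
qed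

lemma design_edge_image:
  assumes "A \<subseteq> grid m"
  shows "design m (edge ` A) = (point ` grid m, (`) point ` grid_orbit m A)"
  unfolding design_def points_eq
  using blocks_of_orbit[OF assms orbit_edge_image[unfolded orbit_def]] by simp

section \<open>The group \<open>G\<close> and the parameters of the designs\<close>

context self_transpose
begin

text \<open>Induction on the generation of \<open>G\<close>: elements of \<open>K\<close> preserve
  the orbit by \<open>orbit_map_prod\<close>, and \<open>tau\<close> does so by
  \<open>orbit_swap\<close>.\<close>

lemma G_group_orbit:
  assumes "g \<in> carrier (G_group m)" "B \<in> grid_orbit m A"
  shows "graph_act g (edge ` B) \<in> (`) edge ` grid_orbit m A"
proof -
  let ?V = "rows m \<union> cols m"
  have K: "graph_act g (edge ` B) \<in> (`) edge ` grid_orbit m A"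
    if "g \<in> carrier (K_group m)" "B \<in> grid_orbit m A" for g B
    using that orbit_map_prod unfolding K_group_carrier by (auto simp: graph_act_vertex_map)
  have tau: "graph_act (tau m) (edge ` B) \<in> (`) edge ` grid_orbit m A" if "B \<in> grid_orbit m A" for B
    using that orbit_swap by (simp add: graph_act_tau grid_orbit_subset[OF A_grid])
  have "g \<in> generate (sym_on ?V) (insert (tau m) (carrier (K_group m)))"
    using assms(1) by (simp add: G_group_def)
  then show ?thesis using assms(2)
  proof (induction arbitrary: B)
    case one
    have "\<one>\<^bsub>sym_on ?V\<^esub> = id" by (simp add: sym_on_def)
    with one show ?case by (simp only: graph_act_id imageI)
  next
    case (incl h)
    then show ?case using K[OF _ incl.prems] tau[OF incl.prems] by (elim insertE) simp_all
  next
    case (inv h)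
    \<comment> \<open>Inverses of generators are generators: \<open>tau\<close> is an involution and
      \<open>K\<close> is closed under inverses.\<close>
    have "inv\<^bsub>sym_on ?V\<^esub> h \<in> insert (tau m) (carrier (K_group m))"
    proof (cases "h = tau m")
      case True
      have "inv\<^bsub>sym_on ?V\<^esub> (tau m) = tau m"
        using tau_mem tau_comp_tau
        by (intro group.inv_equality[OF sym_on_is_group]) (auto simp: sym_on_def)
      then show ?thesis using True by simp
    next
      case False
      then obtain p q where pq: "p permutes {1..m}" "q permutes {1..m}" "h = vertex_map p q"
        using inv.hyps unfolding K_group_carrier by blast
      have perm: "h permutes ?V"
        using vertex_map_permutes[OF pq(1,2)] by (simp add: pq(3) rows_def cols_def)
      have "inv\<^bsub>sym_on ?V\<^esub> h = vertex_map (inv_into UNIV p) (inv_into UNIV q)"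
        unfolding sym_on_inv[OF perm] unfolding pq(3) by (rule inv_vertex_map[OF pq(1,2)])
      then show ?thesis unfolding K_group_carrier using permutes_inv pq(1,2) by blast
    qed
    then show ?case using K[OF _ inv.prems] tau[OF inv.prems] by (elim insertE) simp_all
  next
    case (eng h1 h2)
    obtain B' where "graph_act h2 (edge ` B) = edge ` B'" "B' \<in> grid_orbit m A"
      using eng.IH(2)[OF eng.prems] by (rule imageE)
    moreover have "h1 \<otimes>\<^bsub>sym_on ?V\<^esub> h2 = h1 \<circ> h2" by (simp add: sym_on_def)
    ultimately show ?case using eng.IH(1)[of B'] by (simp only: graph_act_comp)
  qed
qed

text \<open>By \<open>G_group_orbit\<close> the orbit under \<open>G\<close> is no larger than that
  under \<open>K\<close>, and it is no smaller because \<open>G\<close> contains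
  \<open>K\<close>.\<close>

lemma design_hat_eq: "design_hat m (edge ` A) = design m (edge ` A)"
proof -
  have "{graph_act g (edge ` A) | g. g \<in> carrier (G_group m)} = (`) edge ` grid_orbit m A"
  proof (intro equalityI subsetI)
    fix \<Gamma> assume "\<Gamma> \<in> {graph_act g (edge ` A) | g. g \<in> carrier (G_group m)}"
    then show "\<Gamma> \<in> (`) edge ` grid_orbit m A" using G_group_orbit[OF _ grid_orbit_self] by blast
  next
    fix \<Gamma> assume "\<Gamma> \<in> (`) edge ` grid_orbit m A"
    then have "\<Gamma> \<in> orbit (K_group m) graph_act (edge ` A)" by (simp only: orbit_edge_image)
    then obtain g where "g \<in> carrier (K_group m)" "\<Gamma> = graph_act g (edge ` A)"
      by (auto simp: orbit_def)
    moreover have "g \<in> carrier (G_group m)" if "g \<in> carrier (K_group m)" for g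
      using that by (auto simp: G_group_def intro: generate.incl)
    ultimately show "\<Gamma> \<in> {graph_act g (edge ` A) | g. g \<in> carrier (G_group m)}" by blast
  qed
  from blocks_of_orbit[OF A_grid this] show ?thesis
    unfolding design_edge_image[OF A_grid] design_hat_def points_eq by simp
qed

text \<open>Transport along the injection \<open>point\<close>. The point set forces
  \<open>v\<close>, and the block coming from \<open>A\<close> itself forces
  \<open>k'\<close>.\<close>

lemma design_parameters_iff:
  assumes "0 < t"
  shows "is_t_v_k_design t v k' l (design m (edge ` A)) \<longleftrightarrow>
    v = m\<^sup>2 \<and> k' = \<kappa> \<and> 0 < l \<and> (\<forall>T. T \<subseteq> grid m \<and> card T = t \<longrightarrow> cov T = l)"
proof -
  have card_point: "card (point ` X) = card X" for X
    by (simp add: card_image inj_on_subset[OF inj_point])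
  have block_size: "(\<forall>B \<in> (`) point ` grid_orbit m A. B \<subseteq> point ` grid m \<and> card B = k') \<longleftrightarrow> k' = \<kappa>"
  proof
    assume "\<forall>B \<in> (`) point ` grid_orbit m A. B \<subseteq> point ` grid m \<and> card B = k'"
    moreover have "point ` A \<in> (`) point ` grid_orbit m A" by (intro imageI grid_orbit_self)
    ultimately have "card (point ` A) = k'" by blast
    then show "k' = \<kappa>" by (simp add: card_point)
  next
    assume k': "k' = \<kappa>"
    show "\<forall>B \<in> (`) point ` grid_orbit m A. B \<subseteq> point ` grid m \<and> card B = k'"
      by (auto simp: card_point k' grid_orbit_card dest: grid_orbit_subset[OF A_grid])
  qed
  have cover: "card {B \<in> (`) point ` grid_orbit m A. point ` T \<subseteq> B} = cov T" for T
  proof -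
    have "{B \<in> (`) point ` grid_orbit m A. point ` T \<subseteq> B} = (`) point ` {B \<in> grid_orbit m A. T \<subseteq> B}"
      by (auto simp: inj_image_subset_iff[OF inj_point])
    then show ?thesis by (simp add: cov_def card_image inj_image_sets[OF inj_point])
  qed
  have "(\<forall>S. S \<subseteq> point ` grid m \<and> card S = t \<longrightarrow>
      card {B \<in> (`) point ` grid_orbit m A. S \<subseteq> B} = l) \<longleftrightarrow>
    (\<forall>T. T \<subseteq> grid m \<and> card T = t \<longrightarrow> cov T = l)" (is "?L \<longleftrightarrow> ?R")
  proof
    assume L: ?L
    show ?R
    proof (intro allI impI)
      fix T assume T: "T \<subseteq> grid m \<and> card T = t"
      then have "point ` T \<subseteq> point ` grid m \<and> card (point ` T) = t"
        using image_mono card_point by auto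
      with L have "card {B \<in> (`) point ` grid_orbit m A. point ` T \<subseteq> B} = l" by blast
      then show "cov T = l" by (simp only: cover)
    qed
  next
    assume R: ?R
    show ?L
    proof (intro allI impI)
      fix S assume S: "S \<subseteq> point ` grid m \<and> card S = t"
      then obtain T where T: "T \<subseteq> grid m" "S = point ` T" by (auto simp: subset_image_iff)
      then have "cov T = l" using R S card_point by simp
      then show "card {B \<in> (`) point ` grid_orbit m A. S \<subseteq> B} = l"
        unfolding T(2) by (simp only: cover)
    qed
  qed
  moreover have "0 < m\<^sup>2" "0 < \<kappa>" using m3 A_card by auto
  ultimately show ?thesis
    using assms unfolding is_t_v_k_design_def design_edge_image[OF A_grid] fst_conv snd_conv
      block_size card_point card_grid by blast
qed

lemma is_t_design_iff:
  assumes "0 < t"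
  shows "is_t_design t (design m (edge ` A)) \<longleftrightarrow>
    (\<exists>l>0. \<forall>T. T \<subseteq> grid m \<and> card T = t \<longrightarrow> cov T = l)"
  unfolding is_t_design_def design_parameters_iff[OF assms] by blast

text \<open>The two splittings write \<open>(m!)^2\<close> as \<open>m^2 (m - 1)\<close> times
  \<open>(m - 1)! (m - 2)!\<close>.\<close>

lemma fact_m: "(fact m :: real) = real m * fact (m - 1)" "(fact (m - 1) :: real) = (real m - 1) * fact (m - 2)"
proof -
  show "(fact m :: real) = real m * fact (m - 1)" using m3 by (simp add: fact_reduce)
  have "(fact (m - 1) :: real) = real (m - 1) * fact (m - 1 - 1)" using m3 by (intro fact_reduce) simp
  then show "(fact (m - 1) :: real) = (real m - 1) * fact (m - 2)" using m3 by (simp add: of_nat_diff numeral_2_eq_2)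
qed

text \<open>By double counting \<open>l\<close> is the number of blocks times
  \<open>\<kappa> choose t\<close>, divided by \<open>m^2 choose t\<close>. Here \<open>c\<close>
  clears the denominators of both binomials, and \<open>d\<close> is what is left of the second
  after removing \<open>m^2 (m - 1)\<close>, which cancels against the order of
  \<open>K\<close>.\<close>

lemma index_eq:
  assumes "\<forall>T. T \<subseteq> grid m \<and> card T = t \<longrightarrow> cov T = l"
    and "real (\<kappa> choose t) * c = K" "real (m\<^sup>2 choose t) * c = (real m)\<^sup>2 * (real m - 1) * d"
    and "c \<noteq> 0" "d \<noteq> 0"
  shows "real l = K * fact (m - 1) * fact (m - 2) / (d * real (card (K_stabilizer m (edge ` A))))"
proof -
  let ?s = "real (card (K_stabilizer m (edge ` A)))" and ?b = "real (card (grid_orbit m A))"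
  have bs: "?b * ?s = (real m * ((real m - 1) * fact (m - 2))) * (real m * fact (m - 1))"
    using arg_cong[OF card_orbit_stabilizer[of m A], of real] fact_m
    by (simp add: power2_eq_square)
  \<comment> \<open>A nonzero product forces the order of the stabiliser to be nonzero, which
    permits the final division.\<close>
  have "?b * ?s \<noteq> 0" unfolding bs using m3 by simp
  then have s: "?s \<noteq> 0" by auto
  have pos: "(real m)\<^sup>2 * (real m - 1) \<noteq> 0" using m3 by simp
  have "real l * real (m\<^sup>2 choose t) = ?b * real (\<kappa> choose t)"
    using index_orbit[OF assms(1)] by (simp only: of_nat_mult[symmetric])
  then have "real l * (real (m\<^sup>2 choose t) * c) * ?s = (?b * ?s) * (real (\<kappa> choose t) * c)"
    by simp
  then have "(real m)\<^sup>2 * (real m - 1) * (real l * (d * ?s)) =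
      (real m)\<^sup>2 * (real m - 1) * (K * fact (m - 1) * fact (m - 2))"
    unfolding assms(2,3) bs by (simp add: power2_eq_square ac_simps)
  then have "real l * (d * ?s) = K * fact (m - 1) * fact (m - 2)" using pos by simp
  then show ?thesis using s assms(5) by (simp add: field_simps)
qed

end

section \<open>The criteria on the grid read back as statements on \<Delta>\<close>

theorem proposition3p3:
  fixes m k :: nat and \<Delta> :: graph
  assumes "0 < m" and "0 < k"
    and "3 \<le> k" and "real k \<le> (real m)\<^sup>2 / 2"
    and "\<Delta> \<subseteq> Kmm m" and "card \<Delta> = k"
    and "\<exists>g \<in> carrier (K_group m). graph_act (tau m) \<Delta> = graph_act g \<Delta>"
  shows
    "let x = (\<lambda>i. vertex_degree \<Delta> (Row i));
         y = (\<lambda>j. vertex_degree \<Delta> (Col j));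
         D = design m \<Delta>;
         cond_a =
           (real (card (paths 2 \<Delta>)) = (\<Sum>i = 1..m. real (x i) * (real (x i) - 1)) \<and>
            (\<Sum>i = 1..m. real (x i) * (real (x i) - 1)) = (\<Sum>j = 1..m. real (y j) * (real (y j) - 1)) \<and>
            (\<Sum>j = 1..m. real (y j) * (real (y j) - 1)) = real k * (real k - 1) / (real m + 1));
         cond_i =
           (real (card (claws3 \<Delta>)) = 2 * (\<Sum>i = 1..m. real (x i choose 3)) \<and>
            2 * (\<Sum>i = 1..m. real (x i choose 3)) = 2 * (\<Sum>j = 1..m. real (y j choose 3)) \<and>
            2 * (\<Sum>j = 1..m. real (y j choose 3)) =
              real k * (real k - 1) * (real k - 2) * (real m - 2)
                / (3 * (real m + 1) * ((real m)\<^sup>2 - 2)));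
         cond_ii =
           (real (card (paths 3 \<Delta>)) =
              real k * (real k - 1) * (real k - 2) * (real m - 1)
                / ((real m + 1) * ((real m)\<^sup>2 - 2)))
     in design_hat m \<Delta> = D \<and>
        (is_t_design 2 D \<longleftrightarrow> cond_a) \<and>
        (cond_a \<longrightarrow>
          (\<exists>l. is_t_v_k_design 2 (m\<^sup>2) k l D \<and>
             real l = real k * (real k - 1) * fact (m - 1) * fact (m - 2)
                        / ((real m + 1) * real (card (K_stabilizer m \<Delta>))))) \<and>
        (is_t_design 3 D \<longleftrightarrow> cond_a \<and> cond_i \<and> cond_ii) \<and>
        (cond_a \<and> cond_i \<and> cond_ii \<longrightarrow>
          (\<exists>l. is_t_v_k_design 3 (m\<^sup>2) k l D \<and>
             real l = real k * (real k - 1) * (real k - 2) * fact (m - 1) * fact (m - 2)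
                        / ((real m + 1) * ((real m)\<^sup>2 - 2) * real (card (K_stabilizer m \<Delta>)))))"
proof -
  obtain A where A: "A \<subseteq> grid m" "\<Delta> = edge ` A"
    using assms(5) unfolding Kmm_eq by (auto simp: subset_image_iff)
  have card_A: "card A = k"
    using assms(6) unfolding A(2) by (simp add: card_image inj_on_subset[OF inj_edge])
  \<comment> \<open>For \<open>m \<le> 2\<close> the bound \<open>m^2 / 2\<close> would be at most
    2, below \<open>k\<close>.\<close>
  have "3 \<le> m"
  proof (rule ccontr)
    assume "\<not> 3 \<le> m"
    then have "(real m)\<^sup>2 \<le> 2\<^sup>2" by (intro power_mono) auto
    then show False using assms(3,4) by simp
  qed
  obtain p q where "p permutes {1..m}" "q permutes {1..m}"
    "graph_act (tau m) \<Delta> = graph_act (vertex_map p q) \<Delta>"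
    using assms(7) unfolding K_group_carrier by blast
  then have "edge ` prod.swap ` A = edge ` map_prod p q ` A"
    unfolding A(2) graph_act_tau[OF A(1)] graph_act_vertex_map by simp
  then have "prod.swap ` A = map_prod p q ` A" by (simp only: inj_image_eq_iff[OF inj_edge])
  then have "prod.swap ` A \<in> grid_orbit m A"
    unfolding grid_orbit_def using \<open>p permutes {1..m}\<close> \<open>q permutes {1..m}\<close> by blast
  then interpret self_transpose m A
    by unfold_locales (use \<open>3 \<le> m\<close> A(1) card_A assms(3) in auto)
  define x where "x i = vertex_degree \<Delta> (Row i)" for i
  define y where "y j = vertex_degree \<Delta> (Col j)" for j
  have x: "x = row_degree A" and y: "y = col_degree A"
    by (simp_all add: fun_eq_iff x_def y_def A(2) vertex_degree_Row vertex_degree_Col)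
  \<comment> \<open>Row sums and column sums become interchangeable, which reduces each chain of
    equalities in the conditions to a single equation on a number of configurations.\<close>
  have sums: "(\<Sum>i = 1..m. f (x i)) = (\<Sum>j = 1..m. f (y j))" for f :: "nat \<Rightarrow> real"
    unfolding x y by (rule sum_degrees_eq)
  have lines: "real (card (collinear_subsets t A)) = 2 * (\<Sum>j = 1..m. real (y j choose t))"
    if "2 \<le> t" for t
    using card_collinear_subsets[OF A(1) that] sums[of "\<lambda>n. real (n choose t)"]
    by (simp add: x y)
  \<comment> \<open>The factor 2, from rows and columns contributing equally, cancels the 1/2 of
    \<open>choose 2\<close>.\<close>
  have paths2: "real (card (paths 2 \<Delta>)) = (\<Sum>j = 1..m. real (y j) * (real (y j) - 1))"
    unfolding A(2) paths_2_eq card_image_edge lines[of 2, simplified] real_choose_two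
    by (simp add: sum_distrib_left)
  have claws: "real (card (claws3 \<Delta>)) = 2 * (\<Sum>j = 1..m. real (y j choose 3))"
    unfolding A(2) claws3_eq card_image_edge by (rule lines) simp
  \<comment> \<open>The conditions are spelled exactly as in the statement, so that they can be
    folded once the \<open>let\<close> is unfolded.\<close>
  define cond_a where "cond_a \<longleftrightarrow>
    real (card (paths 2 \<Delta>)) = (\<Sum>i = 1..m. real (x i) * (real (x i) - 1)) \<and>
    (\<Sum>i = 1..m. real (x i) * (real (x i) - 1)) = (\<Sum>j = 1..m. real (y j) * (real (y j) - 1)) \<and>
    (\<Sum>j = 1..m. real (y j) * (real (y j) - 1)) = real k * (real k - 1) / (real m + 1)"
  define cond_i where "cond_i \<longleftrightarrow>
    real (card (claws3 \<Delta>)) = 2 * (\<Sum>i = 1..m. real (x i choose 3)) \<and>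
    2 * (\<Sum>i = 1..m. real (x i choose 3)) = 2 * (\<Sum>j = 1..m. real (y j choose 3)) \<and>
    2 * (\<Sum>j = 1..m. real (y j choose 3)) =
      real k * (real k - 1) * (real k - 2) * (real m - 2) / (3 * (real m + 1) * ((real m)\<^sup>2 - 2))"
  define cond_ii where "cond_ii \<longleftrightarrow> real (card (paths 3 \<Delta>)) =
    real k * (real k - 1) * (real k - 2) * (real m - 1) / ((real m + 1) * ((real m)\<^sup>2 - 2))"
  have a: "cond_a \<longleftrightarrow>
      real (card (collinear_subsets 2 A)) = real k * (real k - 1) / (real m + 1)"
    using paths2 sums[of "\<lambda>n. real n * (real n - 1)"]
    unfolding cond_a_def A(2) paths_2_eq card_image_edge by auto
  have i: "cond_i \<longleftrightarrow> real (card (collinear_subsets 3 A)) =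
      real k * (real k - 1) * (real k - 2) * (real m - 2) / (3 * (real m + 1) * ((real m)\<^sup>2 - 2))"
    using claws sums[of "\<lambda>n. real (n choose 3)"]
    unfolding cond_i_def A(2) claws3_eq card_image_edge by auto
  have ii: "cond_ii \<longleftrightarrow> real (card (corners A)) =
      real k * (real k - 1) * (real k - 2) * (real m - 1) / ((real m + 1) * ((real m)\<^sup>2 - 2))"
    unfolding cond_ii_def A(2) paths_3_eq card_image_edge ..
  have two: "is_t_design 2 (design m \<Delta>) \<longleftrightarrow> cond_a"
    unfolding a A(2) is_t_design_iff[OF zero_less_numeral] two_design_iff card_A ..
  have three: "is_t_design 3 (design m \<Delta>) \<longleftrightarrow> cond_a \<and> cond_i \<and> cond_ii"
    unfolding a i ii A(2) is_t_design_iff[OF zero_less_numeral] three_design_iff card_A ..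
  have two_index: "\<exists>l. is_t_v_k_design 2 (m\<^sup>2) k l (design m \<Delta>) \<and>
      real l = real k * (real k - 1) * fact (m - 1) * fact (m - 2)
        / ((real m + 1) * real (card (K_stabilizer m \<Delta>)))" if cond_a
  proof -
    have "is_t_design 2 (design m \<Delta>)" using two that by blast
    then have "\<exists>l>0. \<forall>T. T \<subseteq> grid m \<and> card T = 2 \<longrightarrow> cov T = l"
      unfolding A(2) is_t_design_iff[OF zero_less_numeral] .
    then obtain l where l: "0 < l" "\<forall>T. T \<subseteq> grid m \<and> card T = 2 \<longrightarrow> cov T = l"
      by (elim exE conjE)
    then have "is_t_v_k_design 2 (m\<^sup>2) k l (design m \<Delta>)"
      unfolding A(2) design_parameters_iff[OF zero_less_numeral] card_A by simp
    moreover have "real l = real k * (real k - 1) * fact (m - 1) * fact (m - 2)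
        / ((real m + 1) * real (card (K_stabilizer m \<Delta>)))"
      unfolding A(2)
    \<comment> \<open>Here \<open>c\<close> is \<open>2!\<close> and \<open>d\<close> is
      \<open>m + 1\<close>.\<close>
    proof (rule index_eq[OF l(2), of 2])
      show "real (card A choose 2) * 2 = real k * (real k - 1)" by (simp add: card_A real_choose_two)
      show "real (m\<^sup>2 choose 2) * 2 = (real m)\<^sup>2 * (real m - 1) * (real m + 1)"
        by (simp add: real_square_choose_two)
    qed simp_all
    ultimately show ?thesis by blast
  qed
  have three_index: "\<exists>l. is_t_v_k_design 3 (m\<^sup>2) k l (design m \<Delta>) \<and>
      real l = real k * (real k - 1) * (real k - 2) * fact (m - 1) * fact (m - 2)
        / ((real m + 1) * ((real m)\<^sup>2 - 2) * real (card (K_stabilizer m \<Delta>)))"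
    if "cond_a \<and> cond_i \<and> cond_ii"
  proof -
    have "is_t_design 3 (design m \<Delta>)" using three that by blast
    then have "\<exists>l>0. \<forall>T. T \<subseteq> grid m \<and> card T = 3 \<longrightarrow> cov T = l"
      unfolding A(2) is_t_design_iff[OF zero_less_numeral] .
    then obtain l where l: "0 < l" "\<forall>T. T \<subseteq> grid m \<and> card T = 3 \<longrightarrow> cov T = l"
      by (elim exE conjE)
    then have "is_t_v_k_design 3 (m\<^sup>2) k l (design m \<Delta>)"
      unfolding A(2) design_parameters_iff[OF zero_less_numeral] card_A by simp
    moreover have "real l = real k * (real k - 1) * (real k - 2) * fact (m - 1) * fact (m - 2)
        / ((real m + 1) * ((real m)\<^sup>2 - 2) * real (card (K_stabilizer m \<Delta>)))"
      unfolding A(2)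
    \<comment> \<open>Here \<open>c\<close> is \<open>3!\<close> and \<open>d\<close> is
      \<open>(m + 1) (m^2 - 2)\<close>, nonzero because \<open>m^2\<close> is at least 9.\<close>
    proof (rule index_eq[OF l(2), of 6])
      show "real (card A choose 3) * 6 = real k * (real k - 1) * (real k - 2)"
        by (simp add: card_A real_choose_three)
      show "real (m\<^sup>2 choose 3) * 6 = (real m)\<^sup>2 * (real m - 1) * ((real m + 1) * ((real m)\<^sup>2 - 2))"
        by (simp add: real_square_choose_three)
      show "(real m + 1) * ((real m)\<^sup>2 - 2) \<noteq> 0" using real_v_gt by auto
    qed simp
    ultimately show ?thesis by blast
  qed
  have hat: "design_hat m \<Delta> = design m \<Delta>"
    unfolding A(2) by (rule design_hat_eq)
  show ?thesis
    unfolding Let_def x_def[symmetric] y_def[symmetric]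
      cond_a_def[symmetric] cond_i_def[symmetric] cond_ii_def[symmetric]
    by (intro conjI impI hat two three two_index three_index) simp_all
qed

end
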